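(* Let $f,g\in\mathcal{S}$ with $\frac{f(z)+g(z)}{z}\neq 0$ in the unit disk $\mathbb{D}$. Then the function $F$ defined by $$F(z)=\frac{f(z)+g(z)}{2},\quad z\in\mathbb{D},$$ belongs to $\mathcal{U}$ for $|z|<\frac{1}{\sqrt{2}}r_0$, where $r_0\approx 0.262453$ is the root of the equation $$r^{2}+(1+r^{2})\frac{(2r+r^{2})^{2}}{\left(1-2r-\frac{\pi}{\sqrt[4]{90}}\frac{r^{2}}{\sqrt[4]{1-r^{4}}}\right)^{2}}=1.$$
   Context: $\mathbb{D}=\{z\in\mathbb{C}:|z|<1\}$. $\mathcal{A}$ is the set of all analytic functions $f$ in $\mathbb{D}$ of the form $f(z)=z+\sum_{n=2}^{\infty}a_nz^n$, and $\mathcal{S}$ is the class of univalent (injective) functions in $\mathcal{A}$. $\mathcal{U}$ is the set of all $f\in\mathcal{A}$ such that $f(z)/z\neq 0$ in $\mathbb{D}$ (the value at $0$ being $1$) and $\left|f'(z)\left(\frac{z}{f(z)}\right)^2-1\right|<1$ for all $z\in\mathbb{D}$. The condition $\frac{f(z)+g(z)}{z}\neq 0$ at $z=0$ is understood via the removable singularity. One says that $F$ belongs to $\mathcal{U}$ in the disk $|z|<r$ (or for $|z|<r$) if the inequality $\left|F'(z)\left(\frac{z}{F(z)}\right)^2-1\right|<1$ holds for $|z|<r$ instead of the whole unit disk; equivalently, $G(z)=r^{-1}F(rz)$ belongs to $\mathcal{U}$.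
   Formalization: The quoted value r0≈0.262453 does not satisfy the displayed equation (its left side there is about 2.37), so it is dropped; r0 is taken as the unique root of the equation in (0,1), about 0.2196, giving a smaller disk than the quoted decimal would. *)

theory Defs
  imports "HOL-Complex_Analysis.Complex_Analysis"
begin

text \<open>Functions on the unit disk are total functions on \<^typ>\<open>complex\<close>; only their values on
  \<^term>\<open>ball 0 1\<close> matter.\<close>

definition class_A :: "(complex \<Rightarrow> complex) set" where
  "class_A = {f. f holomorphic_on ball 0 1 \<and>
     (\<exists>a. \<forall>z\<in>ball 0 1. (\<lambda>n. a (n + 2) * z ^ (n + 2)) sums (f z - z))}"

definition class_S :: "(complex \<Rightarrow> complex) set" where
  "class_S = {f \<in> class_A. inj_on f (ball 0 1)}"

text \<open>The function \<open>h(z)/z\<close> with its removable singularity at \<open>0\<close> filled in; meant for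
  holomorphic \<open>h\<close> with \<open>h(0) = 0\<close>.\<close>

definition div_z :: "(complex \<Rightarrow> complex) \<Rightarrow> complex \<Rightarrow> complex" where
  "div_z h z = (if z = 0 then deriv h 0 else h z / z)"

text \<open>The functions in \<^const>\<open>class_A\<close> that belong to the class \<open>U\<close> in the disk \<open>|z| < r\<close>,
  where \<open>0 < r \<le> 1\<close>; the class \<open>U\<close> itself is \<open>class_U 1\<close>. The quotient \<open>z/f(z)\<close> is
  \<open>1 / div_z f z\<close>, so that it has the value 1 at the origin.\<close>

definition class_U :: "real \<Rightarrow> (complex \<Rightarrow> complex) set" where
  "class_U r = {f \<in> class_A. \<forall>z\<in>ball 0 r.
     div_z f z \<noteq> 0 \<and> norm (deriv f z * (1 / div_z f z)\<^sup>2 - 1) < 1}"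

text \<open>The denominator has a zero in \<open>(0,1)\<close>. There the convention \<open>x / 0 = 0\<close> gives the value
  \<open>r\<^sup>2 < 1\<close>, so no spurious solution of \<open>radius_lhs r = 1\<close> arises. The solution in
  \<open>(0,1)\<close> is about 0.219611.\<close>

definition radius_lhs :: "real \<Rightarrow> real" where
  "radius_lhs r = r\<^sup>2 + (1 + r\<^sup>2) * ((2 * r + r\<^sup>2)\<^sup>2 /
     (1 - 2 * r - pi / root 4 90 * (r\<^sup>2 / root 4 (1 - r ^ 4)))\<^sup>2)"

lemma class_A_iff:
  "f \<in> class_A \<longleftrightarrow> f holomorphic_on ball 0 1 \<and> f 0 = 0 \<and> deriv f 0 = 1"
proof
  assume "f \<in> class_A"
  then obtain a where hol: "f holomorphic_on ball 0 1"
    and a: "\<And>z. z \<in> ball 0 1 \<Longrightarrow> (\<lambda>n. a (n + 2) * z ^ (n + 2)) sums (f z - z)"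
    unfolding class_A_def by blast
  have "(\<lambda>n. a (n + 2) * 0 ^ (n + 2)) sums (f 0 - 0)"
    by (rule a) auto
  hence f0: "f 0 = 0" by (simp add: sums_iff)
  define b where "b n = (if n = 0 then 0 else if n = 1 then 1 else a n)" for n
  have b: "(\<lambda>n. b n * (z - 0) ^ n) sums f z" if "z \<in> ball 0 1" for z
  proof -
    have "(\<lambda>n. b (n + 2) * z ^ (n + 2)) sums (f z - (\<Sum>i<2. b i * z ^ i))"
      using a[OF that] by (simp add: b_def numeral_2_eq_2)
    thus ?thesis
      by (subst (asm) sums_iff_shift) simp
  qed
  have "(f has_field_derivative b 1) (at 0)"
  proof -
    have sm: "summable (\<lambda>n. b n * (1 / 2) ^ n)"
      using b[of "1 / 2"] by (auto simp: sums_iff)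
    have "((\<lambda>z. suminf (\<lambda>n. b n * z ^ n)) has_field_derivative
            (\<Sum>n. diffs b n * 0 ^ n)) (at 0)"
      by (rule termdiffs_strong[OF sm]) auto
    also have "(\<Sum>n. diffs b n * 0 ^ n) = b 1"
      by (simp add: diffs_def)
    finally show ?thesis
      by (rule has_field_derivative_transform_within_open[of _ _ _ "ball 0 1"])
         (use b in \<open>auto simp: sums_iff\<close>)
  qed
  hence "deriv f 0 = 1" by (simp add: DERIV_imp_deriv b_def)
  with hol f0 show "f holomorphic_on ball 0 1 \<and> f 0 = 0 \<and> deriv f 0 = 1" by blast
next
  assume f: "f holomorphic_on ball 0 1 \<and> f 0 = 0 \<and> deriv f 0 = 1"
  define a where "a n = (deriv ^^ n) f 0 / fact n" for n
  have "(\<lambda>n. a (n + 2) * z ^ (n + 2)) sums (f z - z)" if "z \<in> ball 0 1" for z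
  proof -
    have "(\<lambda>n. a n * (z - 0) ^ n) sums f z"
      unfolding a_def by (rule holomorphic_power_series) (use f that in auto)
    hence "(\<lambda>n. a (n + 2) * z ^ (n + 2)) sums (f z - (\<Sum>i<2. a i * z ^ i))"
      by (subst sums_iff_shift) simp
    thus ?thesis using f by (simp add: a_def numeral_2_eq_2)
  qed
  thus "f \<in> class_A" using f unfolding class_A_def by blast
qed

lemma class_U_rescale:
  assumes f: "f \<in> class_A" and r: "0 < r" "r \<le> 1"
  shows "f \<in> class_U r \<longleftrightarrow> (\<lambda>z. f (of_real r * z) / of_real r) \<in> class_U 1"
proof -
  let ?g = "\<lambda>z. f (of_real r * z) / of_real r"
  from f have hol: "f holomorphic_on ball 0 1" and f0: "f 0 = 0" and f1: "deriv f 0 = 1"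
    by (auto simp: class_A_iff)
  have ball: "of_real r * z \<in> ball 0 r" if "z \<in> ball 0 1" for z :: complex
    using that r by (simp add: norm_mult)
  have sub: "ball 0 r \<subseteq> (ball 0 1 :: complex set)" using r by auto
  have der: "(?g has_field_derivative deriv f (of_real r * z)) (at z)" if "z \<in> ball 0 1" for z
  proof -
    have "(f has_field_derivative deriv f (of_real r * z)) (at (of_real r * z))"
      using hol ball[OF that] sub by (intro holomorphic_derivI[OF hol]) auto
    moreover have "((\<lambda>z. of_real r * z) has_field_derivative of_real r) (at z)"
      by (auto intro!: derivative_eq_intros)
    ultimately have "((\<lambda>z. f (of_real r * z)) has_field_derivative
        deriv f (of_real r * z) * of_real r) (at z)"
      by (rule DERIV_chain2)
    from DERIV_cdivide[OF this, of "of_real r"] r show ?thesis by simp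
  qed
  have dg: "deriv ?g z = deriv f (of_real r * z)" if "z \<in> ball 0 1" for z
    using der[OF that] by (rule DERIV_imp_deriv)
  have "?g holomorphic_on ball 0 1"
    unfolding holomorphic_on_def field_differentiable_def
    using der by (blast intro: has_field_derivative_at_within)
  hence gA: "?g \<in> class_A"
    using dg[of 0] f0 f1 by (simp add: class_A_iff)
  have qg: "div_z ?g z = div_z f (of_real r * z)" if "z \<in> ball 0 1" for z
    using dg[of 0] r by (simp add: div_z_def)
  have img: "ball 0 r = (\<lambda>z::complex. of_real r * z) ` ball 0 1"
  proof (intro equalityI subsetI)
    fix w :: complex assume "w \<in> ball 0 r"
    hence "w / of_real r \<in> ball 0 1" "w = of_real r * (w / of_real r)"
      using r by (auto simp: norm_divide)
    thus "w \<in> (\<lambda>z. of_real r * z) ` ball 0 1" by blast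
  qed (use ball in auto)
  show ?thesis
    unfolding class_U_def img using f gA by (auto simp: dg qg simp del: mem_ball_0)
qed

end

theory Submission
  imports Defs
begin

text \<open>
  Write \<open>1/f(z) = 1/z + k(z)\<close> and \<open>1/g(z) = 1/z + l(z)\<close>, and put \<open>p = z/f = 1 + z k\<close> and
  \<open>q = z/g = 1 + z l\<close>. With \<open>u = p - z p' - 1 = -z\<^sup>2 k'\<close> and \<open>v = -z\<^sup>2 l'\<close> one has
  \<open>f' (z/f)\<^sup>2 = 1 + u\<close> and \<open>g' (z/g)\<^sup>2 = 1 + v\<close>, and for \<open>F = (f + g)/2\<close> the expression that defines
  the class \<open>U\<close> becomes
  \<open>F' (z/F)\<^sup>2 - 1 = (2 q\<^sup>2 u + 2 p\<^sup>2 v + (p - q)\<^sup>2) / (p + q)\<^sup>2\<close>.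
  For small \<open>|z|\<close> the functions \<open>p\<close>, \<open>q\<close> are near 1 and \<open>u\<close>, \<open>v\<close> are near 0, so the quotient is
  small. The point is to make this uniform over all univalent \<open>f\<close> and \<open>g\<close>, that is, to bound the
  Taylor coefficients \<open>k\<^sub>m\<close> of \<open>k\<close>.

  The bounds come from Gronwall's area theorem: \<open>1/z + k(z)\<close> is injective, hence
  \<open>m |k\<^sub>m|\<^sup>2 \<le> 1\<close> (\<open>area_theorem_coefficient\<close>). Applied to the square-root transform of \<open>f\<close>, it
  gives Bieberbach's inequality \<open>|k\<^sub>0| \<le> 2\<close> (\<open>bieberbach_reciprocal\<close>). Summing the power series gives
  \<open>|p - 1| \<le> 2/5\<close> and \<open>|u| \<le> 1/20\<close> for \<open>|z| \<le> 0.177\<close> (\<open>class_S_small_disk\<close>), and with these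
  numbers the quotient above has modulus less than 1 (\<open>average_U_functional_less_1\<close>).

  The equation for the radius is equivalent to \<open>\<phi>(r) = 1\<close> for a strictly increasing function
  \<open>\<phi>\<close> with \<open>\<phi>(0) = 0\<close> and \<open>\<phi>(1/4) \<ge> 1\<close> (\<open>radius_lhs_eq_1_iff\<close>, \<open>radius_unique\<close>). So it has exactly
  one root \<open>r0\<close> in \<open>(0,1)\<close>, and \<open>r0 \<le> 1/4\<close>. Since \<open>(1/4)/\<surd>2 < 0.177\<close>, the disk of radius
  \<open>r0/\<surd>2\<close> lies where the estimates hold.

  The area theorem itself compares two areas. Let \<open>\<epsilon> < r < 1\<close>. The map \<open>h(z) = 1/z + k(z)\<close> sends the
  annulus \<open>\<epsilon> < |z| < r\<close> injectively into the region enclosed by the image of \<open>|z| = \<epsilon>\<close>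
  (\<open>injective_pole_image_outside\<close>). Up to a translation and small errors this curve is the ellipse
  traced by \<open>1/z + k\<^sub>1 z\<close>, and the real-linear map \<open>w \<mapsto> w - k\<^sub>1 \<epsilon>\<^sup>2 cnj w\<close> turns it into a circle of
  radius about \<open>1/\<epsilon>\<close>. The change of variables formula therefore bounds the integral of
  \<open>|h'|\<^sup>2\<close> over the annulus from above by about \<open>\<pi>/\<epsilon>\<^sup>2\<close>, while orthogonality of the powers of \<open>z\<close> on
  circles bounds it from below by
  \<open>\<pi> (1/\<epsilon>\<^sup>2 - 1/r\<^sup>2 + m |k\<^sub>m|\<^sup>2 (r\<^sup>2\<^sup>m - \<epsilon>\<^sup>2\<^sup>m))\<close>. The terms \<open>\<pi>/\<epsilon>\<^sup>2\<close> cancel; letting \<open>\<epsilon> \<rightarrow> 0\<close> and then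
  \<open>r \<rightarrow> 1\<close> proves the claim.
\<close>

unbundle no fps_syntax

section \<open>Area of injective images in the plane\<close>

lemma det_real_linear_complex:
  fixes a b :: complex
  defines "T \<equiv> \<lambda>v::real^2. Complex (v$1) (v$2)" and "V \<equiv> \<lambda>w. vector [Re w, Im w] :: real^2"
  shows "det (matrix (\<lambda>v. V (a * T v + b * cnj (T v)))) = (norm a)\<^sup>2 - (norm b)\<^sup>2"
  by (simp add: det_2 matrix_def T_def V_def axis_def cmod_def power2_eq_square algebra_simps)

text \<open>The change of variables formula concerns vectors and Fubini's theorem concerns pairs; the coordinate
  map between them maps boxes to boxes of the same measure and so transfers the integral.\<close>

lemma integral_real2_iterated:
  fixes f :: "real^2 \<Rightarrow> real" and a b :: "real^2"
  assumes "continuous_on (cbox a b) f"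
  shows "integral (cbox a b) f =
    integral {a$1..b$1} (\<lambda>x. integral {a$2..b$2} (\<lambda>y. f (vector [x, y])))"
proof -
  let ?g = "\<lambda>p::real\<times>real. vector [fst p, snd p] :: real^2"
  let ?h = "\<lambda>v::real^2. (v$1, v$2)"
  have contg: "continuous_on UNIV ?g"
    by (intro linear_continuous_on linear_conv_bounded_linear[THEN iffD1])
       (auto simp: linear_iff vec_eq_iff forall_2)
  have mem: "x \<in> cbox u v \<longleftrightarrow> fst u \<le> fst x \<and> fst x \<le> fst v \<and> snd u \<le> snd x \<and> snd x \<le> snd v"
    for x u v :: "real \<times> real"
    by (cases x; cases u; cases v) (auto simp: cbox_Pair_eq)
  have img_g: "?g ` cbox u v = cbox (?g u) (?g v)" for u v
  proof (intro equalityI subsetI)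
    fix x assume "x \<in> cbox (?g u) (?g v)"
    then have "?h x \<in> cbox u v" "x = ?g (?h x)"
      by (auto simp: mem mem_box_cart forall_2 vec_eq_iff)
    then show "x \<in> ?g ` cbox u v" by blast
  qed (auto simp: mem mem_box_cart forall_2)
  have img_h: "?h ` cbox u v = cbox (?h u) (?h v)" for u v
  proof (intro equalityI subsetI)
    fix x assume "x \<in> cbox (?h u) (?h v)"
    then have "?g x \<in> cbox u v" "x = ?h (?g x)"
      by (auto simp: mem mem_box_cart forall_2)
    then show "x \<in> ?h ` cbox u v" by blast
  qed (auto simp: mem mem_box_cart forall_2)
  have "(f has_integral integral (cbox a b) f) (cbox a b)"
    using assms integrable_continuous by blast
  then have "((\<lambda>p. f (?g p)) has_integral (1 / 1) *\<^sub>R integral (cbox a b) f) (?h ` cbox a b)"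
  proof (rule has_integral_twiddle[rotated -1])
    show "continuous (at x) ?g" for x :: "real \<times> real"
      using contg unfolding continuous_on_eq_continuous_at[OF open_UNIV] by blast
    show "measure lborel (?g ` cbox u v) = 1 * measure lborel (cbox u v)" for u v :: "real \<times> real"
    proof (cases "cbox u v = {}")
      case False
      then have "cbox (?g u) (?g v) \<noteq> {}"
        unfolding img_g[symmetric] by blast
      then have "measure lborel (?g ` cbox u v) = (fst v - fst u) * (snd v - snd u)"
        unfolding img_g by (simp add: content_cbox_cart UNIV_2)
      moreover from False have "fst u \<le> fst v \<and> snd u \<le> snd v"
        by (auto simp: mem ex_in_conv[symmetric])
      then have "measure lborel (cbox u v) = (fst v - fst u) * (snd v - snd u)"
        by (cases u; cases v) (simp add: content_Pair)
      ultimately show ?thesis by simp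
    qed auto
  qed (use img_g img_h in \<open>auto simp: vec_eq_iff forall_2\<close>)
  then have "integral (cbox a b) f = integral (cbox (?h a) (?h b)) (\<lambda>p. f (?g p))"
    unfolding img_h by (simp add: integral_unique)
  also have "\<dots> = integral (cbox (a$1) (b$1)) (\<lambda>x. integral (cbox (a$2) (b$2)) (\<lambda>y. f (?g (x, y))))"
  proof (rule integral_prod_continuous)
    show "continuous_on (cbox (a $ 1, a $ 2) (b $ 1, b $ 2)) (\<lambda>p. f (?g p))"
      by (intro continuous_on_compose2[OF assms] continuous_on_subset[OF contg]) (auto intro: continuous_on_subset simp: mem_box_cart forall_2)
  qed
  finally show ?thesis by simp
qed

text \<open>The image of the rectangle has the integral of the Jacobian determinant as its area, because the
  map is injective, and it lies in a disk of area \<open>\<pi> R\<^sup>2\<close>. The derivative is written as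
  \<open>h \<mapsto> \<alpha> h + \<beta> cnj h\<close>, the general form of a real-linear map of the plane, whose determinant is
  \<open>|\<alpha>|\<^sup>2 - |\<beta>|\<^sup>2\<close>. Composed with the exponential map, a rectangle parametrizes an annulus, and
  Fubini's theorem then splits the area into integrals over circles.\<close>

lemma injective_image_area_le:
  fixes \<phi> \<alpha> \<beta> :: "complex \<Rightarrow> complex" and a b c d R :: real
  defines "S \<equiv> {s. a < Re s \<and> Re s < b \<and> c < Im s \<and> Im s < d}"
  assumes der: "\<And>s. s \<in> S \<Longrightarrow> (\<phi> has_derivative (\<lambda>h. \<alpha> s * h + \<beta> s * cnj h)) (at s)"
    and inj: "inj_on \<phi> S"
    and bound: "\<phi> ` S \<subseteq> cball 0 R" and R: "0 < R"
    and cont: "continuous_on {s. a \<le> Re s \<and> Re s \<le> b \<and> c \<le> Im s \<and> Im s \<le> d} J"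
    and J: "\<And>s. s \<in> S \<Longrightarrow> (norm (\<alpha> s))\<^sup>2 - (norm (\<beta> s))\<^sup>2 = J s"
  shows "integral {a..b} (\<lambda>x. integral {c..d} (\<lambda>y. \<bar>J (Complex x y)\<bar>)) \<le> pi * R\<^sup>2"
proof -
  let ?T = "\<lambda>v::real^2. Complex (v$1) (v$2)" and ?V = "\<lambda>w. vector [Re w, Im w] :: real^2"
  let ?g = "\<lambda>v. ?V (\<phi> (?T v))"
  let ?g' = "\<lambda>s v. ?V (\<alpha> s * ?T v + \<beta> s * cnj (?T v))"
  let ?a = "vector [a, c] :: real^2" and ?b = "vector [b, d] :: real^2"
  let ?B = "box ?a ?b"
  have T: "(?T has_derivative ?T) F" for F
    by (intro bounded_linear_imp_has_derivative linear_conv_bounded_linear[THEN iffD1])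
       (auto simp: linear_iff complex_eq_iff)
  have V: "(?V has_derivative ?V) F" for F
    by (intro bounded_linear_imp_has_derivative linear_conv_bounded_linear[THEN iffD1])
       (auto simp: linear_iff vec_eq_iff forall_2)
  have B: "?T v \<in> S" if "v \<in> ?B" for v
    using that by (auto simp: S_def mem_box_cart forall_2)
  have derg: "(?g has_derivative ?g' (?T v)) (at v within ?B)" if "v \<in> ?B" for v
  proof -
    have "((\<lambda>v. \<phi> (?T v)) has_derivative (\<lambda>h. \<alpha> (?T v) * ?T h + \<beta> (?T v) * cnj (?T h))) (at v)"
      by (rule has_derivative_compose[OF T der[OF B[OF that]]])
    from has_derivative_compose[OF this V] show ?thesis
      by (rule has_derivative_at_withinI)
  qed
  have injg: "inj_on ?g ?B"
  proof (rule inj_onI)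
    fix u v assume uv: "u \<in> ?B" "v \<in> ?B" "?g u = ?g v"
    then have "\<phi> (?T u) = \<phi> (?T v)"
      by (auto simp: vec_eq_iff forall_2 complex_eq_iff)
    with inj B uv have "?T u = ?T v" by (auto dest: inj_onD)
    then show "u = v" by (auto simp: vec_eq_iff forall_2)
  qed
  have det: "\<bar>det (matrix (?g' (?T v)))\<bar> = \<bar>J (?T v)\<bar>" if "v \<in> ?B" for v
    unfolding det_real_linear_complex J[OF B[OF that]] ..
  have "continuous_on (cbox ?a ?b) ?T"
    by (rule has_derivative_continuous_on[OF T])
  then have contJ: "continuous_on (cbox ?a ?b) (\<lambda>v. \<bar>J (?T v)\<bar>)"
    by (intro continuous_on_rabs continuous_on_compose2[OF cont]) (auto simp: mem_box_cart forall_2)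
  then have int_J: "(\<lambda>v. \<bar>J (?T v)\<bar>) integrable_on ?B"
    by (simp add: integrable_on_open_interval integrable_continuous)
  then have int_det: "(\<lambda>v. \<bar>det (matrix (?g' (?T v)))\<bar>) integrable_on ?B"
    by (subst integrable_cong[OF det])
  have lmeas: "?g ` ?B \<in> lmeasurable"
    using measurable_differentiable_image_eq[OF _ derg injg] int_det by simp
  have "integral {a..b} (\<lambda>x. integral {c..d} (\<lambda>y. \<bar>J (Complex x y)\<bar>))
      = integral (cbox ?a ?b) (\<lambda>v. \<bar>J (?T v)\<bar>)"
    by (subst integral_real2_iterated[OF contJ]) simp
  also have "\<dots> = integral ?B (\<lambda>v. \<bar>det (matrix (?g' (?T v)))\<bar>)"
    by (subst integral_cong[OF det]) (simp_all only: integral_open_interval)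
  also have "\<dots> = measure lebesgue (?g ` ?B)"
    using measure_differentiable_image_eq[OF _ derg injg int_det] by simp
  also have "\<dots> \<le> measure lebesgue (cball 0 R :: (real^2) set)"
  proof (rule measure_mono_fmeasurable)
    have "norm (?V w) = norm w" for w
      by (simp add: norm_vec_def L2_set_def sum_2 cmod_def)
    then show "?g ` ?B \<subseteq> cball 0 R"
      using bound B by fastforce
  qed (use lmeas in auto)
  also have "\<dots> = pi * R\<^sup>2"
    using R by (simp add: content_cball unit_ball_vol_2)
  finally show ?thesis .
qed

section \<open>Integrals over circles\<close>

text \<open>Cauchy's formula for the Taylor coefficient at \<open>0\<close>, read as a Fourier coefficient on the circle of
  radius \<open>t\<close>.\<close>

lemma cis_mean_eq_coefficient:
  fixes f :: "complex \<Rightarrow> complex"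
  assumes f: "f holomorphic_on ball 0 R" and t: "0 < t" "t < R"
  shows "((\<lambda>y. f (of_real t * cis y) * cis (- (real n * y))) has_integral
            2 * pi * of_real t ^ n * ((deriv ^^ n) f 0 / fact n)) {0..2*pi}"
proof -
  have "((\<lambda>u. f u / (u - 0) ^ Suc n) has_contour_integral
          ((2 * pi * \<i>) / fact n * (deriv ^^ n) f 0)) (circlepath 0 t)"
    using t by (intro Cauchy_has_contour_integral_higher_derivative_circlepath
        holomorphic_on_imp_continuous_on holomorphic_on_subset[OF f]) auto
  then have "((\<lambda>y. f (0 + of_real t * cis y) / (0 + of_real t * cis y - 0) ^ Suc n * of_real t * \<i> * cis y)
      has_integral ((2 * pi * \<i>) / fact n * (deriv ^^ n) f 0)) {0..2*pi}"
    unfolding circlepath_def by (subst (asm) has_contour_integral_part_circlepath_iff) auto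
  then have "((\<lambda>y. of_real t ^ n / \<i> * (f (0 + of_real t * cis y) / (0 + of_real t * cis y - 0) ^ Suc n * of_real t * \<i> * cis y))
      has_integral of_real t ^ n / \<i> * ((2 * pi * \<i>) / fact n * (deriv ^^ n) f 0)) {0..2*pi}"
    by (rule has_integral_mult_right)
  moreover have "of_real t ^ n / \<i> * (f (0 + of_real t * cis y) / (0 + of_real t * cis y - 0) ^ Suc n * of_real t * \<i> * cis y)
      = f (of_real t * cis y) * cis (- (real n * y))" for y
  proof -
    have "cis (- (real n * y)) = 1 / cis y ^ n"
      by (simp add: Complex.DeMoivre field_simps cis_mult)
    then show ?thesis unfolding \<open>cis (- (real n * y)) = _\<close> using t
      by (simp add: power_mult_distrib mult.commute[of "f w" \<i> for w])
  qed
  ultimately show ?thesis by (simp add: field_simps)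
qed

lemma norm_diff_sq: "(norm (u - v :: complex))\<^sup>2 = (norm u)\<^sup>2 + (norm v)\<^sup>2 - 2 * Re (cnj v * u)"
  by (simp only: cmod_power2) (simp add: power2_eq_square algebra_simps)

text \<open>This is Bessel's inequality on the circle \<open>|z| = t\<close> for the two powers \<open>z\<^sup>-\<^sup>1\<close> and \<open>z\<^sup>n\<close>. The first
  is orthogonal to \<open>f\<close> since \<open>z f(z)\<close> vanishes at \<open>0\<close>; the contribution of the second is obtained
  by dropping \<open>|f z\<^sup>-\<^sup>n t\<^sup>n - A|\<^sup>2 \<ge> 0\<close>, where \<open>A\<close> is the mean of \<open>f z\<^sup>-\<^sup>n t\<^sup>n\<close>.\<close>

lemma circle_integral_norm_sq_ge:
  fixes f :: "complex \<Rightarrow> complex" and n :: nat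
  assumes f: "f holomorphic_on ball 0 1" and f0: "f 0 = 0" and t: "0 < t" "t < 1"
  defines "a \<equiv> norm ((deriv ^^ n) f 0 / fact n)"
  shows "2 * pi * (1 / t\<^sup>2 + a\<^sup>2 * t ^ (2 * n))
    \<le> integral {0..2*pi} (\<lambda>y. (norm (f (of_real t * cis y) - 1 / (of_real t * cis y)))\<^sup>2)"
proof -
  define A where "A = of_real t ^ n * ((deriv ^^ n) f 0 / fact n)"
  define z where "z y = of_real t * cis y" for y
  have A: "(norm A)\<^sup>2 = a\<^sup>2 * t ^ (2 * n)"
    using t by (simp add: A_def a_def norm_mult norm_divide norm_power power_mult_distrib power_divide mult_ac flip: power_mult)
  have znz: "z y \<noteq> 0" for y using t by (simp add: z_def)
  have cz: "continuous_on X z" for X unfolding z_def by (intro continuous_intros)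
  have zb: "z y \<in> ball 0 1" for y using t by (simp add: z_def norm_mult)
  have I1: "((\<lambda>y. f (z y) * cis (- (real n * y))) has_integral 2 * pi * A) {0..2*pi}"
    using cis_mean_eq_coefficient[OF f t, of n] by (simp add: A_def z_def mult_ac)
  have I2: "((\<lambda>y. z y * f (z y)) has_integral 0) {0..2*pi}"
  proof -
    have "(\<lambda>w. w * f w) holomorphic_on ball 0 1" by (intro holomorphic_intros f)
    from cis_mean_eq_coefficient[OF this t, of 0] show ?thesis by (simp add: z_def)
  qed
  \<comment> \<open>A pointwise lower bound of the integrand whose integral is known exactly.\<close>
  let ?lower = "\<lambda>y. 1 / t\<^sup>2 - (norm A)\<^sup>2 - 2 / t\<^sup>2 * Re (z y * f (z y))
                 + 2 * Re (cnj A * (f (z y) * cis (- (real n * y))))"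
  have lower: "(?lower has_integral
      (2 * pi) * (1 / t\<^sup>2 - (norm A)\<^sup>2) - 2 / t\<^sup>2 * Re 0 + 2 * Re (cnj A * (2 * pi * A))) {0..2*pi}"
  proof (intro has_integral_add has_integral_diff has_integral_mult_right has_integral_Re I2 I1)
    show "((\<lambda>y. 1 / t\<^sup>2 - (norm A)\<^sup>2) has_integral (2 * pi) * (1 / t\<^sup>2 - (norm A)\<^sup>2)) {0..2*pi}"
      using has_integral_const_real[of "1 / t\<^sup>2 - (norm A)\<^sup>2" 0 "2*pi"] by simp
  qed
  have val: "(2 * pi) * (1 / t\<^sup>2 - (norm A)\<^sup>2) - 2 / t\<^sup>2 * Re 0 + 2 * Re (cnj A * (2 * pi * A))
      = 2 * pi * (1 / t\<^sup>2 + a\<^sup>2 * t ^ (2 * n))"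
  proof -
    have "Re (cnj A * (2 * pi * A)) = 2 * pi * (norm A)\<^sup>2"
      by (simp only: cmod_power2) (simp add: cmod_power2 power2_eq_square algebra_simps)
    then show ?thesis by (simp add: A algebra_simps)
  qed
  have "(\<lambda>y. (norm (f (z y) - 1 / z y))\<^sup>2) integrable_on {0..2*pi}"
  proof (intro integrable_continuous_real continuous_intros cz continuous_on_compose2[OF _ cz])
    show "continuous_on (ball 0 1) f" using f holomorphic_on_imp_continuous_on by blast
  qed (use znz zb in auto)
  moreover have "?lower y \<le> (norm (f (z y) - 1 / z y))\<^sup>2" for y
  proof -
    define w where "w = f (z y)"
    have nz: "norm (1 / z y) = 1 / t" using t by (simp add: z_def norm_divide norm_mult)
    have "norm (z y) = t" using t by (simp add: z_def norm_mult)
    then have inv: "cnj (1 / z y) = z y / t\<^sup>2"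
      by (subst complex_div_cnj) simp
    have "(norm (w - 1 / z y))\<^sup>2 = (norm w)\<^sup>2 + (norm (1 / z y))\<^sup>2 - 2 * Re (cnj (1 / z y) * w)"
      by (rule norm_diff_sq)
    also have "\<dots> = (norm w)\<^sup>2 + 1 / t\<^sup>2 - 2 / t\<^sup>2 * Re (z y * w)"
      unfolding inv nz by (simp add: power_divide flip: of_real_power)
    finally have 1: "(norm (w - 1 / z y))\<^sup>2 = (norm w)\<^sup>2 + 1 / t\<^sup>2 - 2 / t\<^sup>2 * Re (z y * w)" .
    have "0 \<le> (norm (w * cis (- (real n * y)) - A))\<^sup>2" by simp
    also have "\<dots> = (norm (w * cis (- (real n * y))))\<^sup>2 + (norm A)\<^sup>2 - 2 * Re (cnj A * (w * cis (- (real n * y))))"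
      by (rule norm_diff_sq)
    also have "norm (w * cis (- (real n * y))) = norm w" by (simp add: norm_mult)
    finally show ?thesis using 1 by (simp add: w_def)
  qed
  ultimately show ?thesis
    using has_integral_le[OF lower integrable_integral] unfolding val z_def by blast
qed

section \<open>Injective functions with a pole\<close>

lemma closed_image_punctured_cball:
  fixes h :: "complex \<Rightarrow> complex"
  assumes cont: "continuous_on (cball 0 \<epsilon> - {0}) h"
    and pole: "filterlim h at_infinity (at 0)"
  shows "closed (h ` (cball 0 \<epsilon> - {0}))"
  unfolding closed_sequential_limits
proof (intro allI impI, elim conjE)
  fix w l assume w: "\<forall>n. w n \<in> h ` (cball 0 \<epsilon> - {0})" and l: "w \<longlonglongrightarrow> l"
  from w have "\<forall>n. \<exists>z. z \<in> cball 0 \<epsilon> - {0} \<and> w n = h z" by blast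
  then obtain z where z: "\<And>n. z n \<in> cball 0 \<epsilon> - {0}" "\<And>n. w n = h (z n)"
    by metis
  obtain p r where p: "p \<in> cball 0 \<epsilon>" and r: "strict_mono r" and lim: "(z \<circ> r) \<longlonglongrightarrow> p"
    using z(1) by (auto intro: seq_compactE[OF compact_cball[of 0 \<epsilon>, THEN compact_imp_seq_compact], of z])
  have hl: "(\<lambda>n. h ((z \<circ> r) n)) \<longlonglongrightarrow> l"
    using LIMSEQ_subseq_LIMSEQ[OF l r] by (simp add: z(2) o_def)
  have "p \<noteq> 0"
  proof
    assume "p = 0"
    then have "filterlim (z \<circ> r) (at 0) sequentially"
      using lim z(1) by (auto simp: filterlim_at)
    from filterlim_compose[OF pole this] hl show False
      using not_tendsto_and_filterlim_at_infinity sequentially_bot by blast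
  qed
  then have p': "p \<in> cball 0 \<epsilon> - {0}" using p by simp
  have "(\<lambda>n. h ((z \<circ> r) n)) \<longlonglongrightarrow> h p"
    by (rule continuous_on_tendsto_compose[OF cont lim p']) (use z(1) in simp)
  with p'
 show "l \<in> h ` (cball 0 \<epsilon> - {0})"
    using LIMSEQ_unique[OF hl] by blast
qed

text \<open>The points outside \<open>C\<close> that are values of \<open>h\<close> on \<open>0 < |z| < \<epsilon>\<close> form an open set, by the open
  mapping theorem, and a relatively closed one, since \<open>h\<close> has a pole at \<open>0\<close> and maps the circle into
  \<open>C\<close>. By connectedness every point outside \<open>C\<close> is such a value, so injectivity leaves only \<open>C\<close> for
  the rest of the disk.\<close>

lemma injective_pole_image_outside:
  fixes h :: "complex \<Rightarrow> complex"
  assumes hol: "h holomorphic_on ball 0 1 - {0}" and inj: "inj_on h (ball 0 1 - {0})"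
    and pole: "filterlim h at_infinity (at 0)"
    and eps: "0 < \<epsilon>" "\<epsilon> < 1"
    and C: "compact C" "connected (- C)" and circle: "\<And>z. norm z = \<epsilon> \<Longrightarrow> h z \<in> C"
    and z: "\<epsilon> \<le> norm z" "norm z < 1"
  shows "h z \<in> C"
proof (rule ccontr)
  assume hz: "h z \<notin> C"
  let ?D = "ball 0 \<epsilon> - {0 :: complex}" and ?K = "cball 0 \<epsilon> - {0 :: complex}"
  have "open (h ` ?D)"
    using eps by (intro open_mapping_thm3 holomorphic_on_subset[OF hol] inj_on_subset[OF inj])
      (auto intro: open_delete)
  then have "openin (top_of_set (- C)) (- C \<inter> h ` ?D)" by auto
  moreover have "closedin (top_of_set (- C)) (- C \<inter> h ` ?K)"
    using eps by (intro closedin_closed_Int closed_image_punctured_cball[OF _ pole]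
       holomorphic_on_imp_continuous_on holomorphic_on_subset[OF hol]) auto
  moreover have "- C \<inter> h ` ?K = - C \<inter> h ` ?D"
  proof -
    have "x \<in> ?D" if "x \<in> ?K" "h x \<notin> C" for x
      using circle[of x] that by (cases "norm x = \<epsilon>") auto
    then show ?thesis by auto
  qed
  ultimately have "- C \<inter> h ` ?D = {} \<or> - C \<inter> h ` ?D = - C"
    using C(2) connected_clopen by metis
  moreover have "- C \<inter> h ` ?D \<noteq> {}"
  proof -
    obtain B where B: "\<And>w. w \<in> C \<Longrightarrow> norm w \<le> B"
      using C(1) compact_imp_bounded bounded_iff by metis
    have "eventually (\<lambda>z. norm (h z) \<ge> \<bar>B\<bar> + 1) (at 0)"
      using pole by (subst (asm) filterlim_at_infinity[of 0]) auto
    then obtain d where "d > 0" and d: "\<And>z. z \<noteq> 0 \<Longrightarrow> norm z < d \<Longrightarrow> norm (h z) \<ge> \<bar>B\<bar> + 1"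
      by (auto simp: eventually_at)
    define t where "t = complex_of_real (min d \<epsilon> / 2)"
    have t: "t \<noteq> 0" "norm t < d" "t \<in> ?D"
      using \<open>d > 0\<close> eps by (auto simp: t_def)
    with d[OF t(1,2)] B[of "h t"] show ?thesis by fastforce
  qed
  ultimately have "h z \<in> h ` ?D" using hz by blast
  then obtain x where x: "x \<in> ?D" "h z = h x" by blast
  have "x \<in> ball 0 1 - {0}" "z \<in> ball 0 1 - {0}" using x(1) z eps by auto
  with inj x(2) have "z = x" by (auto dest: inj_onD)
  with x(1) z show False by simp
qed

section \<open>Gronwall's area theorem\<close>

lemma higher_deriv_id_times:
  assumes g: "g holomorphic_on S" and S: "open S" "0 \<in> S"
  shows "(deriv ^^ n) (\<lambda>z. z * g z) 0 = of_nat n * (deriv ^^ (n - 1)) g 0"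
proof (cases n)
  case (Suc m)
  have "(deriv ^^ n) (\<lambda>z. z * g z) 0 =
      (\<Sum>i=0..n. of_nat (n choose i) * (deriv ^^ i) (\<lambda>z. z) 0 * (deriv ^^ (n - i)) g 0)"
    by (rule higher_deriv_mult[OF _ g S]) (intro holomorphic_intros)
  also have "\<dots> = (\<Sum>i\<in>{1}. of_nat (n choose i) * (deriv ^^ i) (\<lambda>z. z) 0 * (deriv ^^ (n - i)) g 0)"
    by (rule sum.mono_neutral_right) (auto simp: Suc)
  finally show ?thesis by simp
qed simp

text \<open>For \<open>\<beta> = c \<epsilon>\<^sup>2\<close> this real-linear map straightens the ellipse traced by \<open>1/z + c z\<close> on
  \<open>|z| = \<epsilon>\<close> to the circle of radius \<open>1/\<epsilon>\<close>, up to an error of order \<open>\<epsilon>\<^sup>3\<close>, because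
  \<open>cnj (1/z) = z / \<epsilon>\<^sup>2\<close> there. Its determinant is \<open>1 - |\<beta>|\<^sup>2\<close>.\<close>

definition shear :: "complex \<Rightarrow> complex \<Rightarrow> complex" where
  "shear \<beta> w = w - \<beta> * cnj w"

lemma linear_shear: "linear (shear \<beta>)"
  by (auto simp: linear_iff shear_def algebra_simps scaleR_conv_of_real)

lemma norm_shear_ge: "(1 - norm \<beta>) * norm w \<le> norm (shear \<beta> w)"
  using norm_triangle_ineq2[of w "\<beta> * cnj w"] by (simp add: shear_def norm_mult algebra_simps)

lemma shear_eq_0D: "norm \<beta> < 1 \<Longrightarrow> shear \<beta> w = 0 \<Longrightarrow> w = 0"
  using norm_shear_ge[of \<beta> w] by (simp add: mult_le_0_iff)

lemma compact_shear_vimage: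
  assumes "norm \<beta> < 1"
  shows "compact (shear \<beta> -` cball 0 R)" "connected (- (shear \<beta> -` cball 0 R))"
proof -
  have "norm w \<le> R / (1 - norm \<beta>)" if "w \<in> shear \<beta> -` cball 0 R" for w
    using that norm_shear_ge[of \<beta> w] assms by (simp add: field_simps)
  then have "bounded (shear \<beta> -` cball 0 R)" unfolding bounded_iff by blast
  moreover have "closed (shear \<beta> -` cball 0 R)"
    unfolding shear_def by (intro closed_vimage continuous_intros) auto
  moreover have "convex (shear \<beta> -` cball 0 R)"
    by (intro convex_linear_vimage linear_shear convex_cball)
  ultimately show "compact (shear \<beta> -` cball 0 R)" "connected (- (shear \<beta> -` cball 0 R))"
    by (auto simp: compact_eq_bounded_closed connected_complement_bounded_convex)
qed

text \<open>The area of the sheared image of the annulus \<open>\<epsilon> < |z| < r\<close> is compared with the area of the disk of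
  radius \<open>R\<close> that contains it. Subtracting \<open>w\<close> serves to centre the image of the inner circle at
  \<open>0\<close>.\<close>

lemma annulus_area_le:
  fixes k :: "complex \<Rightarrow> complex" and m :: nat
  assumes k: "k holomorphic_on ball 0 1"
    and inj: "inj_on (\<lambda>z. 1 / z + k z) (ball 0 1 - {0})"
    and rad: "0 < \<epsilon>" "\<epsilon> < r" "r < 1" and beta: "norm \<beta> < 1" and R: "0 < R"
    and circle: "\<And>z. norm z = \<epsilon> \<Longrightarrow> norm (shear \<beta> (1 / z + k z - w)) \<le> R"
  defines "a \<equiv> norm ((deriv ^^ m) k 0 / fact m)"
  shows "(1 - (norm \<beta>)\<^sup>2) * (1 / \<epsilon>\<^sup>2 - 1 / r\<^sup>2 + real m * a\<^sup>2 * (r ^ (2 * m) - \<epsilon> ^ (2 * m))) \<le> R\<^sup>2"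
proof -
  let ?h = "\<lambda>z. 1 / z + k z - w"
  define f where "f z = z * deriv k z" for z
  \<comment> \<open>With \<open>z = exp s\<close>, \<open>H\<close> is the derivative of \<open>1 / z + k z\<close> with respect to \<open>s\<close>.\<close>
  define H where "H s = f (exp s) - 1 / exp s" for s
  let ?\<phi> = "\<lambda>s. shear \<beta> (?h (exp s))"
  let ?J = "\<lambda>s. (1 - (norm \<beta>)\<^sup>2) * (norm (H s))\<^sup>2"
  let ?S = "{s. ln \<epsilon> < Re s \<and> Re s < ln r \<and> 0 < Im s \<and> Im s < 2 * pi}"
  have beta2: "0 < 1 - (norm \<beta>)\<^sup>2" using beta by (simp add: power_less_one_iff abs_square_less_1)
  have f: "f holomorphic_on ball 0 1"
    unfolding f_def by (intro holomorphic_intros holomorphic_deriv[OF k]) auto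
  have fm: "norm ((deriv ^^ m) f 0 / fact m) = real m * a"
  proof (cases m)
    case (Suc n)
    have "(deriv ^^ m) f 0 = of_nat m * (deriv ^^ n) (deriv k) 0"
      unfolding f_def using higher_deriv_id_times[OF holomorphic_deriv[OF k], of m] by (simp add: Suc)
    also have "(deriv ^^ n) (deriv k) = (deriv ^^ m) k"
      by (simp add: Suc funpow_swap1)
    finally show ?thesis by (simp add: a_def norm_mult norm_divide)
  qed (simp add: f_def)
  have lnr: "ln r < 0" using rad by simp
  have exp_in: "exp s \<in> ball 0 1 - {0}" "\<epsilon> < norm (exp s)" if "ln \<epsilon> < Re s" "Re s < ln r" for s
  proof -
    have "exp (ln \<epsilon>) < exp (Re s)" "Re s < 0"
      using that(1) order.strict_trans[OF that(2) lnr] by (simp_all only: exp_less_mono)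
    then show "exp s \<in> ball 0 1 - {0}" "\<epsilon> < norm (exp s)" using rad by auto
  qed
  have der: "(?\<phi> has_derivative (\<lambda>h. H s * h + (- \<beta> * cnj (H s)) * cnj h)) (at s)" if "s \<in> ?S" for s
  proof -
    have "(k has_field_derivative deriv k (exp s)) (at (exp s))"
      using exp_in(1)[of s] that by (intro holomorphic_derivI[OF k]) auto
    then have "((\<lambda>s. ?h (exp s)) has_field_derivative H s) (at s)"
      by (auto intro!: derivative_eq_intros DERIV_chain2[of k _ exp] simp: H_def f_def field_simps power2_eq_square)
    then have "((\<lambda>s. ?h (exp s)) has_derivative (\<lambda>h. H s * h)) (at s)"
      by (simp add: has_field_derivative_def)
    from has_derivative_compose[OF this bounded_linear_imp_has_derivative[OF
        linear_conv_bounded_linear[THEN iffD1, OF linear_shear]]]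
    show ?thesis by (simp add: shear_def algebra_simps)
  qed
  have inj\<phi>: "inj_on ?\<phi> ?S"
  proof (rule inj_onI)
    fix s t assume st: "s \<in> ?S" "t \<in> ?S" "?\<phi> s = ?\<phi> t"
    have "shear \<beta> (?h (exp s) - ?h (exp t)) = 0"
      by (simp only: linear_diff[OF linear_shear, of _ "?h (exp s)" "?h (exp t)"] st(3) diff_self)
    then have "?h (exp s) - ?h (exp t) = 0"
      by (rule shear_eq_0D[OF beta])
    then have "?h (exp s) = ?h (exp t)" by (rule eq_iff_diff_eq_0[THEN iffD2])
    then have "1 / exp s + k (exp s) = 1 / exp t + k (exp t)" by simp
    then have "exp s = exp t"
      using inj_onD[OF inj] exp_in(1)[of s] exp_in(1)[of t] st by blast
    moreover have "\<bar>Im s - Im t\<bar> < 2 * pi" using st by auto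
    ultimately show "s = t" using exp_complex_eqI by blast
  qed
  have bound: "?\<phi> ` ?S \<subseteq> cball 0 R"
  proof -
    have "?h z \<in> shear \<beta> -` cball 0 R" if "\<epsilon> \<le> norm z" "norm z < 1" for z
    proof (rule injective_pole_image_outside[of ?h \<epsilon>])
      show "?h holomorphic_on ball 0 1 - {0}"
        by (intro holomorphic_intros holomorphic_on_subset[OF k]) auto
      have "isCont k 0"
        using k by (metis centre_in_ball continuous_on_interior field_differentiable_imp_continuous_at
            holomorphic_on_imp_differentiable_at open_ball zero_less_one)
      moreover have "filterlim (\<lambda>z::complex. 1 / z) at_infinity (at 0)"
        using filterlim_inverse_at_infinity[where 'a = complex]
        unfolding inverse_eq_divide[abs_def] .
      ultimately have "filterlim (\<lambda>z. (k z - w) + 1 / z) at_infinity (at 0)"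
        by (intro tendsto_add_filterlim_at_infinity[where c = "k 0 - w"] tendsto_intros)
           (auto simp: isCont_def)
      then show "filterlim ?h at_infinity (at 0)" by (simp add: algebra_simps)
      show "inj_on ?h (ball 0 1 - {0})" using inj by (simp add: inj_on_def)
    qed (use that circle rad compact_shear_vimage[OF beta] in auto)
    then show ?thesis using exp_in by fastforce
  qed
  let ?box = "{s. ln \<epsilon> \<le> Re s \<and> Re s \<le> ln r \<and> 0 \<le> Im s \<and> Im s \<le> 2 * pi}"
  have contH: "continuous_on ?box H"
  proof -
    have "exp s \<in> ball 0 1" if "s \<in> ?box" for s
    proof -
      have "Re s < 0" using that lnr by (auto intro: le_less_trans)
      then show ?thesis by simp
    qed
    moreover have "continuous_on (ball 0 1) f" using f holomorphic_on_imp_continuous_on by blast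
    ultimately show ?thesis
      unfolding H_def by (intro continuous_intros continuous_on_compose2[of _ f _ exp]) auto
  qed
  have contJ: "continuous_on ?box ?J" by (intro continuous_intros contH)
  let ?I = "\<lambda>x. integral {0..2*pi} (\<lambda>y. \<bar>?J (Complex x y)\<bar>)"
  let ?low = "\<lambda>x. (1 - (norm \<beta>)\<^sup>2) * (2 * pi * (exp (- 2 * x) + (real m * a)\<^sup>2 * exp (2 * real m * x)))"
  \<comment> \<open>An antiderivative of the lower bound for the integral over the circle of radius \<open>exp x\<close>.\<close>
  let ?prim = "\<lambda>x. (1 - (norm \<beta>)\<^sup>2) * pi * (- exp (- 2 * x) + real m * a\<^sup>2 * exp (2 * real m * x))"
  have le: "ln \<epsilon> \<le> ln r" using rad by simp
  have "(?low has_integral (?prim (ln r) - ?prim (ln \<epsilon>))) {ln \<epsilon>..ln r}"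
  proof (rule fundamental_theorem_of_calculus[OF le])
    show "(?prim has_vector_derivative ?low x) (at x within {ln \<epsilon>..ln r})" for x
      unfolding has_real_derivative_iff_has_vector_derivative[symmetric]
      by (auto intro!: derivative_eq_intros simp: algebra_simps power2_eq_square)
  qed
  moreover have "?I integrable_on {ln \<epsilon>..ln r}"
  proof (intro integrable_continuous_real)
    have "continuous_on ({ln \<epsilon>..ln r} \<times> cbox 0 (2 * pi)) (\<lambda>p. \<bar>?J (Complex (fst p) (snd p))\<bar>)"
      by (intro continuous_on_rabs continuous_on_compose2[OF contJ] continuous_intros) auto
    then show "continuous_on {ln \<epsilon>..ln r} ?I"
      using integral_continuous_on_param[of "{ln \<epsilon>..ln r}" 0 "2 * pi" "\<lambda>x y. \<bar>?J (Complex x y)\<bar>"]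
      by (simp add: case_prod_unfold)
  qed
  moreover have "?low x \<le> ?I x" if "x \<in> {ln \<epsilon>..ln r}" for x
  proof -
    have t: "0 < exp x" "exp x < 1"
      using le_less_trans[OF _ lnr] that by auto
    have "Complex x y = of_real x + \<i> * of_real y" for y by (simp add: complex_eq_iff)
    then have *: "exp (Complex x y) = of_real (exp x) * cis y" for y
      by (simp add: exp_add cis_conv_exp exp_of_real)
    have e: "1 / (exp x)\<^sup>2 = exp (- 2 * x)" "exp x ^ (2 * m) = exp (2 * real m * x)"
      by (simp_all add: exp_minus field_simps flip: exp_of_nat_mult exp_double)
    have "?low x \<le> (1 - (norm \<beta>)\<^sup>2) *
        integral {0..2*pi} (\<lambda>y. (norm (f (of_real (exp x) * cis y) - 1 / (of_real (exp x) * cis y)))\<^sup>2)"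
      using circle_integral_norm_sq_ge[OF f _ t, of m] beta2
      unfolding fm e by (intro mult_left_mono) (auto simp: f_def)
    also have "\<dots> = ?I x"
      using beta2 by (simp add: H_def * abs_mult)
    finally show ?thesis .
  qed
  ultimately have "?prim (ln r) - ?prim (ln \<epsilon>) \<le> integral {ln \<epsilon>..ln r} ?I"
    using has_integral_le integrable_integral by blast
  also have "\<dots> \<le> pi * R\<^sup>2"
  proof (rule injective_image_area_le[OF der inj\<phi> bound R contJ])
    show "(norm (H s))\<^sup>2 - (norm (- \<beta> * cnj (H s)))\<^sup>2 = ?J s" for s
      by (simp add: norm_mult power_mult_distrib algebra_simps)
  qed
  finally have "pi * ((1 - (norm \<beta>)\<^sup>2) * ((- exp (- 2 * ln r) + real m * a\<^sup>2 * exp (2 * real m * ln r))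
       - (- exp (- 2 * ln \<epsilon>) + real m * a\<^sup>2 * exp (2 * real m * ln \<epsilon>)))) \<le> pi * R\<^sup>2"
    by (simp add: algebra_simps)
  then have "(1 - (norm \<beta>)\<^sup>2) * ((- exp (- 2 * ln r) + real m * a\<^sup>2 * exp (2 * real m * ln r))
       - (- exp (- 2 * ln \<epsilon>) + real m * a\<^sup>2 * exp (2 * real m * ln \<epsilon>))) \<le> R\<^sup>2"
    by simp
  moreover have "exp (- 2 * ln x) = 1 / x\<^sup>2" "exp (2 * real m * ln x) = x ^ (2 * m)" if "0 < x" for x :: real
  proof -
    show "exp (- 2 * ln x) = 1 / x\<^sup>2"
      using that exp_of_nat_mult[of 2 "ln x"] by (simp add: exp_minus field_simps)
    show "exp (2 * real m * ln x) = x ^ (2 * m)"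
      using that exp_of_nat_mult[of "2 * m" "ln x"] by simp
  qed
  ultimately show ?thesis using rad by (simp add: algebra_simps)
qed

text \<open>The bound \<open>M \<epsilon>\<^sup>2\<close> on the deviation from the circle of radius \<open>1/\<epsilon>\<close> is what makes the comparison of
  areas sharp: it changes the area of the disk by a term of order \<open>\<epsilon>\<close> only, whereas without the shear
  the deviation \<open>c z\<close> of order \<open>\<epsilon>\<close> would change it by a constant.\<close>

lemma shear_circle_bound:
  fixes k :: "complex \<Rightarrow> complex"
  assumes k: "k holomorphic_on ball 0 1"
  obtains M where "0 \<le> M"
    "\<And>z \<epsilon>. norm z = \<epsilon> \<Longrightarrow> 0 < \<epsilon> \<Longrightarrow> \<epsilon> \<le> 1 / 2 \<Longrightarrow>
       norm (shear (deriv k 0 * of_real (\<epsilon>\<^sup>2)) (1 / z + k z - k 0)) \<le> 1 / \<epsilon> + M * \<epsilon>\<^sup>2"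
proof -
  define c where "c = deriv k 0"
  have sub: "cball 0 (1 / 2) \<subseteq> (ball 0 1 :: complex set)" by auto
  have k': "(deriv ^^ i) k holomorphic_on ball 0 1" for i
    by (intro holomorphic_higher_deriv[OF k]) auto
  have "compact ((deriv ^^ 2) k ` cball 0 (1 / 2))"
    by (intro compact_continuous_image holomorphic_on_imp_continuous_on holomorphic_on_subset[OF k' sub]) auto
  then obtain K where K: "\<And>z. z \<in> cball 0 (1 / 2) \<Longrightarrow> norm ((deriv ^^ 2) k z) \<le> K" "0 < K"
    using compact_imp_bounded bounded_pos by (metis (no_types, lifting) image_eqI)
  have taylor: "norm (k z - k 0 - c * z) \<le> K * (norm z)\<^sup>2" if "z \<in> cball 0 (1 / 2)" for z
  proof -
    have "norm ((deriv ^^ 0) k z - (\<Sum>i\<le>1. (deriv ^^ i) k 0 * (z - 0) ^ i / fact i))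
        \<le> K * norm (z - 0) ^ Suc 1 / fact 1"
    proof (rule complex_Taylor[where S = "cball 0 (1 / 2)" and f = "\<lambda>i. (deriv ^^ i) k"])
      show "((deriv ^^ i) k has_field_derivative (deriv ^^ Suc i) k x) (at x within cball 0 (1 / 2))"
        if "x \<in> cball 0 (1 / 2)" for i x
        using holomorphic_derivI[OF k' open_ball, of x i] that sub
        by (auto intro: has_field_derivative_at_within)
    qed (use K that in \<open>auto simp: numeral_2_eq_2\<close>)
    then show ?thesis by (simp add: c_def numeral_2_eq_2 algebra_simps)
  qed
  define M where "M = K + (norm c)\<^sup>2 + norm c * K"
  have "norm (shear (c * of_real (\<epsilon>\<^sup>2)) (1 / z + k z - k 0)) \<le> 1 / \<epsilon> + M * \<epsilon>\<^sup>2"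
    if z: "norm z = \<epsilon>" "0 < \<epsilon>" "\<epsilon> \<le> 1 / 2" for z \<epsilon>
  proof -
    define e where "e = k z - k 0 - c * z"
    have e: "norm e \<le> K * \<epsilon>\<^sup>2" using taylor[of z] z by (simp add: e_def)
    \<comment> \<open>On the circle the shear removes \<open>c z\<close> exactly, since \<open>\<epsilon>\<^sup>2 cnj (1/z) = z\<close>.\<close>
    have "cnj (1 / z) = z / of_real (\<epsilon>\<^sup>2)"
      using z by (subst complex_div_cnj) simp
    then have cnj_eq: "of_real (\<epsilon>\<^sup>2) * cnj (1 / z) = z" using z by simp
    have "1 / z + k z - k 0 = 1 / z + c * z + e" by (simp add: e_def)
    then have "shear (c * of_real (\<epsilon>\<^sup>2)) (1 / z + k z - k 0) =
        1 / z + c * z + e - c * (of_real (\<epsilon>\<^sup>2) * cnj (1 / z)) - c * of_real (\<epsilon>\<^sup>2) * cnj (c * z + e)"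
      by (simp add: shear_def algebra_simps del: complex_cnj_divide)
    also have "\<dots> = 1 / z + (e - c * of_real (\<epsilon>\<^sup>2) * (cnj (c * z) + cnj e))"
      unfolding cnj_eq by (simp add: algebra_simps)
    also have "norm \<dots> \<le> norm (1 / z) + (norm e + norm c * \<epsilon>\<^sup>2 * (norm c * \<epsilon> + norm e))"
    proof -
      have "norm (c * of_real (\<epsilon>\<^sup>2) * (cnj (c * z) + cnj e)) = norm c * \<epsilon>\<^sup>2 * norm (cnj (c * z) + cnj e)"
        using z by (simp add: norm_mult norm_power)
      also have "\<dots> \<le> norm c * \<epsilon>\<^sup>2 * (norm (cnj (c * z)) + norm (cnj e))"
        by (intro mult_left_mono norm_triangle_ineq) auto
      also have "\<dots> = norm c * \<epsilon>\<^sup>2 * (norm c * \<epsilon> + norm e)"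
        using z by (simp add: norm_mult)
      finally show ?thesis
        by (intro order.trans[OF norm_triangle_ineq] add_left_mono order.trans[OF norm_triangle_ineq4])
    qed
    also have "norm (1 / z) = 1 / \<epsilon>" using z by (simp add: norm_divide)
    also have "norm e + norm c * \<epsilon>\<^sup>2 * (norm c * \<epsilon> + norm e) \<le>
        K * \<epsilon>\<^sup>2 + norm c * \<epsilon>\<^sup>2 * (norm c * 1 + K * 1)"
    proof (intro add_mono e mult_left_mono)
      have "\<epsilon>\<^sup>2 \<le> 1" using z by (simp add: power_le_one)
      then show "norm e \<le> K * 1" using e K(2) by (intro order.trans[OF e] mult_left_mono) auto
    qed (use z in auto)
    also have "\<dots> = M * \<epsilon>\<^sup>2" by (simp add: M_def power2_eq_square algebra_simps)
    finally show ?thesis by simp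
  qed
  moreover have "0 \<le> M" using K(2) by (simp add: M_def)
  ultimately show thesis using that unfolding c_def by blast
qed

text \<open>Gronwall's area theorem, for one coefficient. In the comparison of areas the terms \<open>1/\<epsilon>\<^sup>2\<close> on both
  sides cancel, and the limits \<open>\<epsilon> \<rightarrow> 0\<close> and \<open>r \<rightarrow> 1\<close> remove all the error terms.\<close>

theorem area_theorem_coefficient:
  fixes k :: "complex \<Rightarrow> complex"
  assumes k: "k holomorphic_on ball 0 1"
    and inj: "inj_on (\<lambda>z. 1 / z + k z) (ball 0 1 - {0})"
  shows "real m * (norm ((deriv ^^ m) k 0 / fact m))\<^sup>2 \<le> 1"
proof (cases "m = 0")
  case m: False
  define a where "a = norm ((deriv ^^ m) k 0 / fact m)"
  define c where "c = norm (deriv k 0)"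
  obtain M where M: "0 \<le> M"
    "\<And>z \<epsilon>. norm z = \<epsilon> \<Longrightarrow> 0 < \<epsilon> \<Longrightarrow> \<epsilon> \<le> 1 / 2 \<Longrightarrow>
       norm (shear (deriv k 0 * of_real (\<epsilon>\<^sup>2)) (1 / z + k z - k 0)) \<le> 1 / \<epsilon> + M * \<epsilon>\<^sup>2"
    using shear_circle_bound[OF k] by blast
  have ineq: "(1 - c\<^sup>2 * \<epsilon> ^ 4) * (- 1 / r\<^sup>2 + real m * a\<^sup>2 * (r ^ (2 * m) - \<epsilon> ^ (2 * m))) - c\<^sup>2 * \<epsilon>\<^sup>2
      \<le> 2 * M * \<epsilon> + M\<^sup>2 * \<epsilon> ^ 4"
    if e: "0 < \<epsilon>" "\<epsilon> < r" "\<epsilon> \<le> 1 / 2" "c * \<epsilon>\<^sup>2 < 1" and r: "r < 1" for \<epsilon> r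
  proof -
    define X where "X = - 1 / r\<^sup>2 + real m * a\<^sup>2 * (r ^ (2 * m) - \<epsilon> ^ (2 * m))"
    have nb: "norm (deriv k 0 * of_real (\<epsilon>\<^sup>2)) = c * \<epsilon>\<^sup>2"
      by (simp add: c_def norm_mult norm_power)
    have circle: "norm (shear (deriv k 0 * of_real (\<epsilon>\<^sup>2)) (1 / z + k z - k 0)) \<le> 1 / \<epsilon> + M * \<epsilon>\<^sup>2"
      if "norm z = \<epsilon>" for z
      by (rule M(2)[OF that e(1,3)])
    have "0 < 1 / \<epsilon> + M * \<epsilon>\<^sup>2" using e M(1) by (simp add: add_pos_nonneg)
    from annulus_area_le[OF k inj e(1,2) r _ this circle, of m, unfolded nb, OF e(4), folded a_def]
    have "(1 - (c * \<epsilon>\<^sup>2)\<^sup>2) * (1 / \<epsilon>\<^sup>2 - 1 / r\<^sup>2 + real m * a\<^sup>2 * (r ^ (2 * m) - \<epsilon> ^ (2 * m)))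
        \<le> (1 / \<epsilon> + M * \<epsilon>\<^sup>2)\<^sup>2" .
    also have "1 / \<epsilon>\<^sup>2 - 1 / r\<^sup>2 + real m * a\<^sup>2 * (r ^ (2 * m) - \<epsilon> ^ (2 * m)) = 1 / \<epsilon>\<^sup>2 + X"
      by (simp add: X_def)
    also have "(1 - (c * \<epsilon>\<^sup>2)\<^sup>2) * (1 / \<epsilon>\<^sup>2 + X) = 1 / \<epsilon>\<^sup>2 + ((1 - c\<^sup>2 * \<epsilon> ^ 4) * X - c\<^sup>2 * \<epsilon>\<^sup>2)"
      using e by (simp add: power2_eq_square power4_eq_xxxx field_simps)
    also have "(1 / \<epsilon> + M * \<epsilon>\<^sup>2)\<^sup>2 = 1 / \<epsilon>\<^sup>2 + (2 * M * \<epsilon> + M\<^sup>2 * \<epsilon> ^ 4)"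
      using e by (simp add: power2_eq_square power4_eq_xxxx field_simps)
    finally show ?thesis unfolding X_def by simp
  qed
  have bound: "real m * a\<^sup>2 * r ^ (2 * m) \<le> 1 / r\<^sup>2" if r: "0 < r" "r < 1" for r
  proof -
    have "(\<lambda>\<epsilon>. c * \<epsilon>\<^sup>2) \<midarrow>0\<rightarrow> 0" by (auto intro!: tendsto_eq_intros)
    then have "eventually (\<lambda>\<epsilon>. c * \<epsilon>\<^sup>2 < 1) (at_right 0)"
      by (intro order_tendstoD(2)[of _ 0] filterlim_at_split[THEN iffD1, THEN conjunct2]) auto
    moreover have "eventually (\<lambda>\<epsilon>. \<epsilon> \<in> {0<..<min r (1 / 2)}) (at_right 0)"
      using r by (intro eventually_at_right_real) auto
    ultimately have "eventually (\<lambda>\<epsilon>. (1 - c\<^sup>2 * \<epsilon> ^ 4) * (- 1 / r\<^sup>2 + real m * a\<^sup>2 * (r ^ (2 * m) - \<epsilon> ^ (2 * m))) - c\<^sup>2 * \<epsilon>\<^sup>2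
      \<le> 2 * M * \<epsilon> + M\<^sup>2 * \<epsilon> ^ 4) (at_right 0)"
      by eventually_elim (use ineq r in auto)
    moreover have "((\<lambda>\<epsilon>. (1 - c\<^sup>2 * \<epsilon> ^ 4) * (- 1 / r\<^sup>2 + real m * a\<^sup>2 * (r ^ (2 * m) - \<epsilon> ^ (2 * m))) - c\<^sup>2 * \<epsilon>\<^sup>2)
        \<longlongrightarrow> (1 - c\<^sup>2 * 0 ^ 4) * (- 1 / r\<^sup>2 + real m * a\<^sup>2 * (r ^ (2 * m) - 0 ^ (2 * m))) - c\<^sup>2 * 0\<^sup>2) (at_right 0)"
      by (intro tendsto_intros)
    moreover have "((\<lambda>\<epsilon>. 2 * M * \<epsilon> + M\<^sup>2 * \<epsilon> ^ 4) \<longlongrightarrow> 2 * M * 0 + M\<^sup>2 * 0 ^ 4) (at_right 0)"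
      by (intro tendsto_intros)
    ultimately have "(1 - c\<^sup>2 * 0 ^ 4) * (- 1 / r\<^sup>2 + real m * a\<^sup>2 * (r ^ (2 * m) - 0 ^ (2 * m))) - c\<^sup>2 * 0\<^sup>2 \<le> 2 * M * 0 + M\<^sup>2 * 0 ^ 4"
      by (intro tendsto_le[OF trivial_limit_at_right_real])
    then show ?thesis using m by (simp add: power_0_left)
  qed
  have "eventually (\<lambda>r. real m * a\<^sup>2 * r ^ (2 * m) \<le> 1 / r\<^sup>2) (at_left (1 :: real))"
    using eventually_at_left_real[of 0 1] by (rule eventually_mono) (use bound in auto)
  moreover have "((\<lambda>r. real m * a\<^sup>2 * r ^ (2 * m)) \<longlongrightarrow> real m * a\<^sup>2 * 1 ^ (2 * m)) (at_left (1 :: real))"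
    "((\<lambda>r. 1 / r\<^sup>2) \<longlongrightarrow> 1 / 1\<^sup>2) (at_left (1 :: real))"
    by (intro tendsto_intros; simp)+
  ultimately have "real m * a\<^sup>2 * 1 ^ (2 * m) \<le> 1 / 1\<^sup>2"
    by (intro tendsto_le[OF trivial_limit_at_left_real])
  then show ?thesis by (simp add: a_def)
qed simp

section \<open>Reciprocals of univalent functions\<close>

lemma div_z_holomorphic:
  assumes f: "f holomorphic_on ball 0 1" and f0: "f 0 = 0"
  shows "div_z f holomorphic_on ball 0 1"
proof -
  have "(\<lambda>z. if z = 0 then deriv f 0 else (f z - f 0) / (z - 0)) holomorphic_on ball 0 1"
    by (rule pole_lemma_open[OF f]) auto
  then show ?thesis by (simp add: div_z_def[abs_def] f0 cong: if_cong)
qed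

lemma times_div_z: "f 0 = 0 \<Longrightarrow> z * div_z f z = f z"
  by (simp add: div_z_def)

lemma holomorphic_eq_value_plus_id_times:
  assumes f: "f holomorphic_on ball 0 1"
  obtains k where "k holomorphic_on ball 0 1" "\<And>z. f z = f 0 + z * k z" "k 0 = deriv f 0"
proof
  have "(\<lambda>z. f z - f 0) holomorphic_on ball 0 1" by (intro holomorphic_intros f)
  from div_z_holomorphic[OF this]
  show "div_z (\<lambda>z. f z - f 0) holomorphic_on ball 0 1" by simp
  show "f z = f 0 + z * div_z (\<lambda>z. f z - f 0) z" for z
    by (simp add: times_div_z)
  have "f field_differentiable at 0"
    using f holomorphic_on_imp_differentiable_at[of f "ball 0 1" 0] by auto
  then show "div_z (\<lambda>z. f z - f 0) 0 = deriv f 0"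
    by (simp add: div_z_def)
qed

text \<open>An injective \<open>f\<close> vanishes only at \<open>0\<close>, so \<open>z/f\<close> is holomorphic in the whole disk; and
  \<open>1/z + k = 1/f\<close> inherits injectivity from \<open>f\<close>.\<close>

lemma class_S_reciprocal:
  assumes "f \<in> class_S"
  obtains k where "k holomorphic_on ball 0 1"
    "\<And>z. z \<in> ball 0 1 \<Longrightarrow> div_z f z * (1 + z * k z) = 1"
    "inj_on (\<lambda>z. 1 / z + k z) (ball 0 1 - {0})"
proof -
  from assms have f: "f holomorphic_on ball 0 1" and f0: "f 0 = 0" and f1: "deriv f 0 = 1"
    and inj: "inj_on f (ball 0 1)"
    by (auto simp: class_S_def class_A_iff)
  have nz: "div_z f z \<noteq> 0" if "z \<in> ball 0 1" for z
    using inj_onD[OF inj, of z 0] that by (auto simp: div_z_def f0 f1)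
  have "(\<lambda>z. 1 / div_z f z) holomorphic_on ball 0 1"
    using nz by (intro holomorphic_intros div_z_holomorphic f f0) auto
  then obtain k where k: "k holomorphic_on ball 0 1"
    and eq: "\<And>z. 1 / div_z f z = 1 / div_z f 0 + z * k z"
    using holomorphic_eq_value_plus_id_times by blast
  have eq': "1 + z * k z = 1 / div_z f z" for z
    by (simp add: eq[of z]) (simp add: div_z_def f1)
  have "1 / z + k z = 1 / f z" if "z \<noteq> 0" for z
  proof -
    have "1 / z + k z = (1 + z * k z) / z" using that by (simp add: field_simps)
    also have "\<dots> = 1 / f z" unfolding eq' using that by (simp add: div_z_def)
    finally show ?thesis .
  qed
  then have "inj_on (\<lambda>z. 1 / z + k z) (ball 0 1 - {0})"
    using inj by (auto simp: inj_on_def)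
  with k eq' nz show thesis by (intro that[of k]) auto
qed

text \<open>Bieberbach's inequality \<open>|a\<^sub>2| \<le> 2\<close>: if \<open>1/f = 1/z + k\<close>, then \<open>k 0 = -a\<^sub>2\<close>. The odd function
  \<open>\<surd>f(z\<^sup>2)\<close> is again univalent, and its reciprocal is \<open>1/z + k2(z)\<close> with \<open>k2(z) = (k 0 / 2) z + \<dots>\<close>;
  the area theorem for the coefficient of \<open>z\<close> gives \<open>|k 0 / 2| \<le> 1\<close>.\<close>

lemma bieberbach_reciprocal:
  assumes k: "k holomorphic_on ball 0 1" and nz: "\<And>z. z \<in> ball 0 1 \<Longrightarrow> 1 + z * k z \<noteq> 0"
    and inj: "inj_on (\<lambda>z. 1 / z + k z) (ball 0 1 - {0})"
  shows "norm (k 0) \<le> 2"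
proof -
  let ?p = "\<lambda>z. 1 + z * k z"
  have p: "?p holomorphic_on ball 0 1" by (intro holomorphic_intros k)
  obtain g0 where g0: "g0 holomorphic_on ball 0 1" "\<And>z. z \<in> ball 0 1 \<Longrightarrow> ?p z = g0 z ^ 2"
    using contractible_imp_holomorphic_sqrt[OF p convex_imp_contractible[OF convex_ball] nz] by metis
  \<comment> \<open>Of the two square roots of \<open>1 + z k\<close>, the one with value 1 at the origin.\<close>
  define g where "g z = g0 z / g0 0" for z
  have g00: "(g0 0)\<^sup>2 = 1" using g0(2)[of 0] by simp
  then have g00': "g0 0 \<noteq> 0" by auto
  have g: "g holomorphic_on ball 0 1" unfolding g_def by (intro holomorphic_intros g0) (use g00' in auto)
  have g_sq: "?p z = (g z)\<^sup>2" if "z \<in> ball 0 1" for z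
    using g0(2)[OF that] by (simp add: g_def power_divide g00)
  have g1: "g 0 = 1" using g00' by (simp add: g_def)
  obtain e where e: "e holomorphic_on ball 0 1" "\<And>z. g z = g 0 + z * e z" "e 0 = deriv g 0"
    using holomorphic_eq_value_plus_id_times[OF g] by blast
  have "k 0 = 2 * e 0"
  proof -
    have der: "((\<lambda>z. 1 + z * h z) has_field_derivative h 0) (at 0)" if h: "h holomorphic_on ball 0 1" for h
    proof -
      have "(h has_field_derivative deriv h 0) (at 0)"
        by (rule holomorphic_derivI[OF h]) auto
      from DERIV_add[OF DERIV_const DERIV_mult[OF DERIV_ident this]] show ?thesis by simp
    qed
    have "((\<lambda>z. (1 + z * e z)\<^sup>2) has_field_derivative 2 * e 0) (at 0)"
      using DERIV_power[OF der[OF e(1)], of 2] by simp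
    moreover from der[OF k] have "((\<lambda>z. (1 + z * e z)\<^sup>2) has_field_derivative k 0) (at 0)"
    proof (rule has_field_derivative_transform_within_open[of _ _ _ "ball 0 1"])
      show "?p z = (1 + z * e z)\<^sup>2" if "z \<in> ball 0 1" for z
        using g_sq[OF that] e(2)[of z] g1 by simp
    qed auto
    ultimately show ?thesis by (rule DERIV_unique[rotated])
  qed
  define k2 where "k2 z = z * e (z\<^sup>2)" for z
  have sq: "z\<^sup>2 \<in> ball 0 1" if "z \<in> ball 0 1" for z :: complex
    using that by (simp add: norm_power power_less_one_iff)
  have e_sq: "(\<lambda>z. e (z\<^sup>2)) holomorphic_on ball 0 1"
  proof -
    have "e \<circ> (\<lambda>z. z\<^sup>2) holomorphic_on ball 0 1"
      by (rule holomorphic_on_compose_gen[OF _ e(1)]) (use sq in \<open>auto intro!: holomorphic_intros\<close>)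
    then show ?thesis by (simp add: o_def)
  qed
  have k2: "k2 holomorphic_on ball 0 1"
    unfolding k2_def by (intro holomorphic_intros e_sq)
  have "inj_on (\<lambda>z. 1 / z + k2 z) (ball 0 1 - {0})"
  proof (rule inj_onI)
    fix z w :: complex
    assume zw: "z \<in> ball 0 1 - {0}" "w \<in> ball 0 1 - {0}" "1 / z + k2 z = 1 / w + k2 w"
    have root: "1 / z + k2 z = g (z\<^sup>2) / z" if "z \<noteq> 0" for z
      using that e(2)[of "z\<^sup>2"] by (simp add: k2_def g1 field_simps power2_eq_square)
    have square: "(1 / z + k2 z)\<^sup>2 = 1 / z\<^sup>2 + k (z\<^sup>2)" if "z \<in> ball 0 1 - {0}" for z
      using that g_sq[OF sq, of z] root[of z] by (simp add: power_divide field_simps)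
    have "1 / z\<^sup>2 + k (z\<^sup>2) = 1 / w\<^sup>2 + k (w\<^sup>2)"
      using square[OF zw(1)] square[OF zw(2)] zw(3) by simp
    then have "z\<^sup>2 = w\<^sup>2"
      by (rule inj_onD[OF inj]) (use sq[of z] sq[of w] zw(1,2) in auto)
    moreover have "z \<noteq> - w"
    proof
      assume "z = - w"
      then have "g (w\<^sup>2) / w = - (g (w\<^sup>2) / w)" using zw root[of z] root[of w] by simp
      then have "g (w\<^sup>2) = 0" using zw by (simp add: eq_neg_iff_add_eq_0)
      then show False using g_sq[of "w\<^sup>2"] nz[of "w\<^sup>2"] sq[of w] zw by simp
    qed
    ultimately show "z = w" by (simp add: power2_eq_iff)
  qed
  then have "real 1 * (norm ((deriv ^^ 1) k2 0 / fact 1))\<^sup>2 \<le> 1"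
    by (rule area_theorem_coefficient[OF k2])
  moreover have "(deriv ^^ 1) k2 0 = e 0"
    unfolding k2_def by (subst higher_deriv_id_times[OF e_sq]) auto
  ultimately have "norm (e 0) \<le> 1" by (simp add: abs_square_le_1)
  then show ?thesis using \<open>k 0 = 2 * e 0\<close> by (simp add: norm_mult)
qed

lemma unit_coefficients_bounds:
  assumes k: "k holomorphic_on ball 0 1"
    and coeff: "\<And>m. m \<ge> 1 \<Longrightarrow> norm ((deriv ^^ m) k 0 / fact m) \<le> 1"
    and z: "norm z < 1"
  shows "norm (k z) \<le> norm (k 0) + norm z / (1 - norm z)" "norm (deriv k z) \<le> 1 / (1 - norm z)\<^sup>2"
proof -
  define a where "a n = (deriv ^^ n) k 0 / fact n" for n
  have a: "norm (a (Suc n)) \<le> 1" for n unfolding a_def by (rule coeff) simp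
  have zb: "z \<in> ball 0 1" using z by simp
  have geo: "(\<lambda>n. norm z ^ n) sums (1 / (1 - norm z))" using z by (intro geometric_sums) simp
  have "(\<lambda>n. a n * (z - 0) ^ n) sums k z"
    unfolding a_def by (rule holomorphic_power_series[OF k zb])
  then have "(\<lambda>n. a (Suc n) * z ^ Suc n) sums (k z - k 0)"
    by (subst sums_Suc_iff) (simp add: a_def)
  moreover have "norm (a (Suc n) * z ^ Suc n) \<le> norm z ^ n * norm z" for n
    using mult_right_mono[OF a[of n], of "norm z ^ Suc n"]
    by (simp add: norm_mult norm_power mult_ac)
  moreover have "(\<lambda>n. norm z ^ n * norm z) sums (1 / (1 - norm z) * norm z)"
    by (rule sums_mult2[OF geo])
  ultimately have "norm (k z - k 0) \<le> norm z / (1 - norm z)"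
    using norm_sums_le by fastforce
  then show "norm (k z) \<le> norm (k 0) + norm z / (1 - norm z)"
    using norm_triangle_ineq2[of "k z" "k 0"] by linarith
  have "(\<lambda>n. (deriv ^^ n) (deriv k) 0 / fact n * (z - 0) ^ n) sums deriv k z"
    by (rule holomorphic_power_series[OF _ zb]) (intro holomorphic_deriv k open_ball)
  moreover have "(deriv ^^ n) (deriv k) 0 / fact n = of_nat (Suc n) * a (Suc n)" for n
    by (simp add: a_def funpow_swap1 field_simps del: of_nat_Suc)
  ultimately have "(\<lambda>n. of_nat (Suc n) * a (Suc n) * z ^ n) sums deriv k z" by simp
  moreover have "(\<lambda>n. of_nat (Suc n) * norm z ^ n) sums (1 / (1 - norm z)\<^sup>2)"
    using z by (intro geometric_deriv_sums) simp
  moreover have "norm (of_nat (Suc n) * a (Suc n) * z ^ n) \<le> of_nat (Suc n) * norm z ^ n" for n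
    using mult_left_mono[OF a[of n], of "real (Suc n) * norm z ^ n"]
    by (simp add: norm_mult norm_power mult_ac del: of_nat_Suc)
  ultimately show "norm (deriv k z) \<le> 1 / (1 - norm z)\<^sup>2"
    by (rule norm_sums_le)
qed

text \<open>Here \<open>p = z/f\<close> and \<open>u = f' (z/f)\<^sup>2 - 1\<close>. The bounds are \<open>\<rho> (2 + \<rho>/(1-\<rho>))\<close> and
  \<open>(\<rho>/(1-\<rho>))\<^sup>2\<close> evaluated at \<open>\<rho> = 0.177\<close> and rounded up.\<close>

lemma class_S_small_disk:
  assumes f: "f \<in> class_S" and z: "norm z \<le> 177 / 1000"
  obtains p u where "div_z f z * p = 1" "deriv f z = (1 + u) / p\<^sup>2"
    "norm (p - 1) \<le> 2 / 5" "norm u \<le> 1 / 20"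
proof -
  from f have hol: "f holomorphic_on ball 0 1" and f0: "f 0 = 0"
    by (auto simp: class_S_def class_A_iff)
  have zb: "z \<in> ball 0 1" using z by simp
  obtain k where k: "k holomorphic_on ball 0 1"
    and recip: "\<And>z. z \<in> ball 0 1 \<Longrightarrow> div_z f z * (1 + z * k z) = 1"
    and inj: "inj_on (\<lambda>z. 1 / z + k z) (ball 0 1 - {0})"
    using class_S_reciprocal[OF f] by blast
  have coeff: "norm ((deriv ^^ m) k 0 / fact m) \<le> 1" if "m \<ge> 1" for m
  proof -
    have "1 * (norm ((deriv ^^ m) k 0 / fact m))\<^sup>2 \<le> real m * (norm ((deriv ^^ m) k 0 / fact m))\<^sup>2"
      using that by (intro mult_right_mono) auto
    also have "\<dots> \<le> 1" by (rule area_theorem_coefficient[OF k inj])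
    finally show ?thesis by (simp add: abs_square_le_1)
  qed
  have k0: "norm (k 0) \<le> 2"
    using recip by (intro bieberbach_reciprocal[OF k _ inj]) force
  define p where "p z = 1 + z * k z" for z
  have pnz: "p z \<noteq> 0" using recip[OF zb] by (auto simp: p_def)
  define u where "u = - (z\<^sup>2 * deriv k z)"
  have f_eq: "f w = w / p w" if "w \<in> ball 0 1" for w
  proof -
    have "p w \<noteq> 0" "div_z f w * p w = 1" using recip[OF that] by (auto simp: p_def)
    then have "div_z f w = 1 / p w" by (simp add: eq_divide_imp)
    then show ?thesis using times_div_z[of f w] f0 by simp
  qed
  have "(k has_field_derivative deriv k z) (at z)"
    using zb by (intro holomorphic_derivI[OF k]) auto
  then have "((\<lambda>w. w / p w) has_field_derivative (1 + u) / (p z)\<^sup>2) (at z)"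
    using pnz unfolding p_def
    by (auto intro!: derivative_eq_intros simp: u_def power2_eq_square algebra_simps)
  then have "(f has_field_derivative (1 + u) / (p z)\<^sup>2) (at z)"
    by (rule has_field_derivative_transform_within_open[OF _ open_ball zb]) (simp add: f_eq)
  then have der: "deriv f z = (1 + u) / (p z)\<^sup>2" by (rule DERIV_imp_deriv)
  note bounds = unit_coefficients_bounds[OF k coeff, of z]
  have d: "norm z / (1 - norm z) \<le> (177 / 1000) / (1 - 177 / 1000)"
    using z by (intro frac_le) auto
  have kz: "norm (k z) \<le> 2 + (177 / 1000) / (1 - 177 / 1000)"
  proof -
    have "norm z < 1" using zb by simp
    from bounds(1)[OF _ this] k0 d show ?thesis by linarith
  qed
  have "norm (p z - 1) = norm z * norm (k z)" by (simp add: p_def norm_mult)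
  also have "\<dots> \<le> 177 / 1000 * (2 + (177 / 1000) / (1 - 177 / 1000))"
    using z by (intro mult_mono kz) auto
  also have "\<dots> \<le> 2 / 5" by simp
  finally have "norm (p z - 1) \<le> 2 / 5" .
  moreover have "norm u \<le> 1 / 20"
  proof -
    have "norm u = (norm z)\<^sup>2 * norm (deriv k z)" by (simp add: u_def norm_mult norm_power)
    also have "\<dots> \<le> (norm z)\<^sup>2 * (1 / (1 - norm z)\<^sup>2)"
      using z by (intro mult_left_mono bounds(2)) auto
    also have "\<dots> = (norm z / (1 - norm z))\<^sup>2" by (simp add: power_divide)
    also have "\<dots> \<le> ((177 / 1000) / (1 - 177 / 1000))\<^sup>2"
      using z d by (intro power_mono) auto
    also have "\<dots> \<le> 1 / 20" by (simp add: power2_eq_square)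
    finally show ?thesis .
  qed
  ultimately show thesis using that[of "p z" u] recip[OF zb] der by (simp add: p_def)
qed

text \<open>Here \<open>a = 1/p\<close> and \<open>b = 1/q\<close>, so \<open>(a + b)/2\<close> is \<open>F/z\<close> for the average \<open>F\<close>, and the first factor in
  the norm is \<open>F'\<close>. After simplification the numerator is at most
  \<open>4 \<cdot> 1.4\<^sup>2 / 20 + 0.8\<^sup>2 = 1.032\<close>, and the denominator is at least \<open>1.2\<^sup>2 = 1.44\<close>.\<close>

lemma average_U_functional_less_1:
  fixes p q u v :: complex
  assumes p: "norm (p - 1) \<le> 2 / 5" and q: "norm (q - 1) \<le> 2 / 5"
    and u: "norm u \<le> 1 / 20" and v: "norm v \<le> 1 / 20"
    and a: "a * p = 1" and b: "b * q = 1"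
  shows "a + b \<noteq> 0" "norm (((1 + u) / p\<^sup>2 + (1 + v) / q\<^sup>2) / 2 * (1 / ((a + b) / 2))\<^sup>2 - 1) < 1"
proof -
  have sum: "6 / 5 \<le> norm (p + q)"
  proof -
    have "p + q = 2 + ((p - 1) + (q - 1))" by simp
    then have "norm (2 :: complex) - norm ((p - 1) + (q - 1)) \<le> norm (p + q)"
      using norm_diff_ineq[of 2 "(p - 1) + (q - 1)"] by (simp only:)
    moreover have "norm ((p - 1) + (q - 1)) \<le> norm (p - 1) + norm (q - 1)"
      by (rule norm_triangle_ineq)
    ultimately show ?thesis using p q by simp
  qed
  then have pq: "p + q \<noteq> 0" by auto
  have nz: "p \<noteq> 0" "q \<noteq> 0" using a b by auto
  have ab: "a = 1 / p" "b = 1 / q" using a b nz by (auto simp: field_simps)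
  have ab_eq: "(a + b) / 2 = (p + q) / (2 * p * q)" using nz by (simp add: ab field_simps)
  show "a + b \<noteq> 0"
  proof
    assume "a + b = 0"
    then have "(p + q) / (2 * p * q) = 0" unfolding ab_eq[symmetric] by simp
    then show False using pq nz by simp
  qed
  let ?N = "2 * q\<^sup>2 * u + 2 * p\<^sup>2 * v + (p - q)\<^sup>2"
  have eq: "((1 + u) / p\<^sup>2 + (1 + v) / q\<^sup>2) / 2 * (1 / ((a + b) / 2))\<^sup>2 - 1 = ?N / (p + q)\<^sup>2"
  proof -
    have "((1 + u) / p\<^sup>2 + (1 + v) / q\<^sup>2) / 2 * (1 / ((a + b) / 2))\<^sup>2
        = ((1 + u) * q\<^sup>2 + (1 + v) * p\<^sup>2) / (p\<^sup>2 * q\<^sup>2) / 2 * ((2 * p * q)\<^sup>2 / (p + q)\<^sup>2)"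
      unfolding ab_eq using nz by (simp add: power_divide add_frac_eq)
    also have "\<dots> = 2 * ((1 + u) * q\<^sup>2 + (1 + v) * p\<^sup>2) / (p + q)\<^sup>2"
    proof -
      have "X / (p\<^sup>2 * q\<^sup>2) / 2 * ((2 * p * q)\<^sup>2 / S) = 2 * X / S" for X S
        using nz by (simp add: power_mult_distrib)
      then show ?thesis .
    qed
    also have "\<dots> - 1 = (2 * ((1 + u) * q\<^sup>2 + (1 + v) * p\<^sup>2) - (p + q)\<^sup>2) / (p + q)\<^sup>2"
      using pq by (simp add: diff_divide_distrib)
    also have "2 * ((1 + u) * q\<^sup>2 + (1 + v) * p\<^sup>2) - (p + q)\<^sup>2 = ?N"
      by (simp add: power2_eq_square algebra_simps)
    finally show ?thesis .
  qed
  have np: "norm p \<le> 7 / 5" "norm q \<le> 7 / 5"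
    using p q norm_triangle_ineq2[of p 1] norm_triangle_ineq2[of q 1] by simp_all
  have "norm (2 * x\<^sup>2 * w) \<le> 2 * (7 / 5)\<^sup>2 * (1 / 20)" if "norm x \<le> 7 / 5" "norm w \<le> 1 / 20" for x w :: complex
    unfolding norm_mult norm_power using that by (intro mult_mono power_mono) auto
  then have "norm (2 * q\<^sup>2 * u) \<le> 2 * (7 / 5)\<^sup>2 * (1 / 20)" "norm (2 * p\<^sup>2 * v) \<le> 2 * (7 / 5)\<^sup>2 * (1 / 20)"
    using np u v by blast+
  moreover have "norm ((p - q)\<^sup>2) \<le> (4 / 5)\<^sup>2"
  proof -
    have "norm (p - q) \<le> 4 / 5"
      using norm_triangle_ineq4[of "p - 1" "q - 1"] p q by simp
    then show ?thesis unfolding norm_power by (intro power_mono) auto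
  qed
  ultimately have "norm ?N \<le> 2 * (7 / 5)\<^sup>2 * (1 / 20) + 2 * (7 / 5)\<^sup>2 * (1 / 20) + (4 / 5)\<^sup>2"
    by (intro order.trans[OF norm_triangle_ineq] add_mono)
  also have "\<dots> < (6 / 5)\<^sup>2" by (simp add: power2_eq_square)
  also have "\<dots> \<le> (norm (p + q))\<^sup>2" using sum by (intro power_mono) auto
  finally have "norm ?N < (norm (p + q))\<^sup>2" .
  then show "norm (((1 + u) / p\<^sup>2 + (1 + v) / q\<^sup>2) / 2 * (1 / ((a + b) / 2))\<^sup>2 - 1) < 1"
    unfolding eq using pq by (simp add: norm_divide norm_power)
qed

section \<open>The equation for the radius\<close>

text \<open>Let \<open>D\<close> be the expression squared in the denominator of \<open>radius_lhs r\<close>. Since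
  \<open>s\<^sup>4 = (1 - r\<^sup>2)(1 + r\<^sup>2)\<close>, the equation says \<open>s\<^sup>2 |D| = B\<close> with \<open>B = (1 + r\<^sup>2)(2r + r\<^sup>2)\<close>. A negative
  \<open>D\<close> is impossible: with \<open>u = r\<^sup>2/s\<close> and \<open>\<kappa> \<le> 2\<close> one gets \<open>-D \<le> 2r + u + u\<^sup>2\<close>, and
  \<open>s\<^sup>2 (2r + u + u\<^sup>2) \<le> 2r + r\<^sup>2 + r\<^sup>4 < B\<close>. So only \<open>s\<^sup>2 D = B\<close> remains.\<close>

lemma radius_lhs_eq_1_iff:
  assumes r: "0 < r" "r < 1"
  defines "s \<equiv> root 4 (1 - r ^ 4)" and "\<kappa> \<equiv> pi / root 4 90"
  shows "radius_lhs r = 1 \<longleftrightarrow> 2 * r + \<kappa> * (r\<^sup>2 / s) + (1 + r\<^sup>2) * (2 * r + r\<^sup>2) / s\<^sup>2 = 1"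
proof -
  define D where "D = 1 - 2 * r - \<kappa> * (r\<^sup>2 / s)"
  define B where "B = (1 + r\<^sup>2) * (2 * r + r\<^sup>2)"
  have r2: "0 < r\<^sup>2" "r\<^sup>2 < 1" using r by (auto simp: power_less_one_iff abs_square_less_1)
  have r4: "0 < 1 - r ^ 4" using r by (simp add: power_less_one_iff)
  have s: "0 < s" "s \<le> 1" using r4 r by (auto simp: s_def)
  have s4: "s ^ 4 = (1 - r\<^sup>2) * (1 + r\<^sup>2)"
  proof -
    have "s ^ 4 = 1 - r ^ 4" using r4 by (simp add: s_def)
    then show ?thesis by (simp add: power2_eq_square power4_eq_xxxx algebra_simps)
  qed
  have B: "0 < B" using r by (simp add: B_def add_pos_pos)
  have kappa: "0 \<le> \<kappa>" "\<kappa> \<le> 2"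
  proof -
    have "root 4 (2 ^ 4) \<le> root 4 90" by (rule real_root_le_mono) auto
    then have "2 \<le> root 4 (90 :: real)" by (simp add: real_root_power_cancel)
    then show "0 \<le> \<kappa>" "\<kappa> \<le> 2" using pi_less_4 by (auto simp: \<kappa>_def field_simps)
  qed
  have "radius_lhs r = 1 \<longleftrightarrow> D \<noteq> 0 \<and> (1 + r\<^sup>2) * (2 * r + r\<^sup>2)\<^sup>2 = (1 - r\<^sup>2) * D\<^sup>2"
    using r2 unfolding radius_lhs_def D_def[symmetric] s_def[symmetric] \<kappa>_def[symmetric]
    by (cases "D = 0") (auto simp: field_simps)
  also have "\<dots> \<longleftrightarrow> D \<noteq> 0 \<and> B\<^sup>2 = (s\<^sup>2 * D)\<^sup>2"
  proof -
    have "B\<^sup>2 = (1 + r\<^sup>2) * ((1 + r\<^sup>2) * (2 * r + r\<^sup>2)\<^sup>2)"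
      by (simp add: B_def power2_eq_square mult_ac)
    moreover have "(s\<^sup>2 * D)\<^sup>2 = s ^ 4 * D\<^sup>2"
      by (simp add: power_mult_distrib)
    then have "(s\<^sup>2 * D)\<^sup>2 = (1 + r\<^sup>2) * ((1 - r\<^sup>2) * D\<^sup>2)"
      by (simp add: s4 mult_ac)
    moreover have "1 + r\<^sup>2 \<noteq> 0" using r2 by linarith
    ultimately show ?thesis by simp
  qed
  also have "\<dots> \<longleftrightarrow> B = s\<^sup>2 * D"
  proof -
    have "B \<noteq> - (s\<^sup>2 * D)"
    proof -
      define u where "u = r\<^sup>2 / s"
      have u: "0 < u" "u * s = r\<^sup>2" using s r2 by (auto simp: u_def)
      have "\<kappa> * u \<le> 2 * u" using kappa u by (intro mult_right_mono) auto
      also have "2 * u \<le> u + (1 + u\<^sup>2)"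
        using sum_squares_bound[of u 1] u by (simp add: power2_eq_square)
      finally have "- D \<le> 2 * r + u + u\<^sup>2" by (simp add: D_def u_def)
      then have "s\<^sup>2 * (- D) \<le> s\<^sup>2 * (2 * r + u + u\<^sup>2)"
        by (intro mult_left_mono) auto
      also have "\<dots> = 2 * r * s\<^sup>2 + r\<^sup>2 * s + r ^ 4"
      proof -
        have "s\<^sup>2 * u = r\<^sup>2 * s" "s\<^sup>2 * u\<^sup>2 = (u * s)\<^sup>2" using u by (auto simp: power2_eq_square mult_ac)
        moreover have "(r\<^sup>2)\<^sup>2 = r ^ 4" by simp
        ultimately show ?thesis unfolding u(2) by (simp add: distrib_left mult_ac)
      qed
      also have "\<dots> \<le> 2 * r * 1 + r\<^sup>2 * 1 + r ^ 4"
        using s r by (intro add_mono mult_left_mono order.refl) (auto simp: power_le_one)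
      also have "\<dots> < B"
      proof -
        have "B = 2 * r + r\<^sup>2 + r ^ 4 + 2 * r ^ 3"
          by (simp add: B_def power2_eq_square power3_eq_cube power4_eq_xxxx algebra_simps)
        then show ?thesis using r by simp
      qed
      finally show ?thesis by simp
    qed
    then show ?thesis using B s by (auto simp: power2_eq_iff)
  qed
  also have "\<dots> \<longleftrightarrow> 2 * r + \<kappa> * (r\<^sup>2 / s) + (1 + r\<^sup>2) * (2 * r + r\<^sup>2) / s\<^sup>2 = 1"
    unfolding B_def[symmetric] D_def using s by (auto simp: field_simps)
  finally show ?thesis .
qed

text \<open>Each summand of the reformulated equation increases with \<open>r\<close>, which gives uniqueness; already the
  first and third summands exceed 1 together at \<open>r = 1/4\<close>, which locates the root.\<close>

lemma radius_unique:
  obtains r0 where "0 < r0" "r0 \<le> 1 / 4" "{r. 0 < r \<and> r < 1 \<and> radius_lhs r = 1} = {r0}"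
proof -
  define s :: "real \<Rightarrow> real" where "s r = root 4 (1 - r ^ 4)" for r
  define \<kappa> where "\<kappa> = pi / root 4 90"
  define \<phi> where "\<phi> r = 2 * r + \<kappa> * (r\<^sup>2 / s r) + (1 + r\<^sup>2) * (2 * r + r\<^sup>2) / (s r)\<^sup>2" for r
  have kappa: "0 \<le> \<kappa>" by (simp add: \<kappa>_def)
  have s: "0 < s r" if "0 \<le> r" "r < 1" for r
    using that by (simp add: s_def power_less_one_iff)
  have mono: "\<phi> x < \<phi> y" if "0 \<le> x" "x < y" "y < 1" for x y
  proof -
    have "x ^ 4 \<le> y ^ 4" using that by (intro power_mono) auto
    then have "s y \<le> s x" by (simp add: s_def)
    moreover have "0 < s y" using that by (intro s) auto
    ultimately have "\<kappa> * (x\<^sup>2 / s x) \<le> \<kappa> * (y\<^sup>2 / s y)"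
      "(1 + x\<^sup>2) * (2 * x + x\<^sup>2) / (s x)\<^sup>2 \<le> (1 + y\<^sup>2) * (2 * y + y\<^sup>2) / (s y)\<^sup>2"
      using that kappa by (auto intro!: mult_left_mono frac_le mult_mono add_mono power_mono)
    then show ?thesis using that by (simp add: \<phi>_def)
  qed
  have "\<exists>r. 0 \<le> r \<and> r \<le> 1 / 4 \<and> \<phi> r = 1"
  proof (rule IVT')
    show "\<phi> 0 \<le> 1" by (simp add: \<phi>_def)
    have "0 < s (1 / 4)" "s (1 / 4) \<le> 1" by (rule s) (auto simp: s_def)
    then have "(s (1 / 4))\<^sup>2 \<le> 1" "0 < (s (1 / 4))\<^sup>2" by (auto simp: power_le_one)
    then have "(1 + (1 / 4)\<^sup>2) * (2 * (1 / 4) + (1 / 4)\<^sup>2) / 1 \<le> (1 + (1 / 4)\<^sup>2) * (2 * (1 / 4) + (1 / 4)\<^sup>2) / (s (1 / 4))\<^sup>2"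
      by (intro divide_left_mono) auto
    moreover have "0 \<le> \<kappa> * ((1 / 4)\<^sup>2 / s (1 / 4))"
      using kappa \<open>0 < s (1 / 4)\<close> by simp
    ultimately show "1 \<le> \<phi> (1 / 4)"
      by (simp add: \<phi>_def power2_eq_square)
    show "continuous_on {0..1 / 4} \<phi>"
    proof -
      have "continuous_on {0..1 / 4} s" unfolding s_def by (intro continuous_intros)
      moreover have "s r \<noteq> 0" if "r \<in> {0..1 / 4}" for r using s[of r] that by auto
      ultimately show ?thesis unfolding \<phi>_def by (intro continuous_intros) auto
    qed
  qed auto
  then obtain r0 where r0: "0 \<le> r0" "r0 \<le> 1 / 4" "\<phi> r0 = 1" by blast
  then have "0 < r0" by (cases "r0 = 0") (auto simp: \<phi>_def)
  moreover have "radius_lhs r = 1 \<longleftrightarrow> r = r0" if "0 < r" "r < 1" for r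
  proof -
    have "radius_lhs r = 1 \<longleftrightarrow> \<phi> r = 1"
      unfolding \<phi>_def s_def \<kappa>_def by (rule radius_lhs_eq_1_iff[OF that])
    then show ?thesis using mono[of r r0] mono[of r0 r] r0 that by force
  qed
  ultimately show thesis using r0 by (intro that) auto
qed

section \<open>Averages of univalent functions\<close>

theorem theorem5:
  shows "\<exists>r0::real. {r. 0 < r \<and> r < 1 \<and> radius_lhs r = 1} = {r0} \<and>
    (\<forall>f\<in>class_S. \<forall>g\<in>class_S.
       (\<forall>z\<in>ball 0 1. div_z (\<lambda>w. f w + g w) z \<noteq> 0) \<longrightarrow>
       (\<lambda>z. (f z + g z) / 2) \<in> class_U (r0 / sqrt 2))"
proof -
  obtain r0 where r0: "0 < r0" "r0 \<le> 1 / 4" and root: "{r. 0 < r \<and> r < 1 \<and> radius_lhs r = 1} = {r0}"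
    by (rule radius_unique)
  have radius: "r0 / sqrt 2 \<le> 177 / 1000"
  proof -
    have "250 / 177 \<le> sqrt 2" by (rule real_le_rsqrt) (simp add: power2_eq_square)
    then have "r0 / sqrt 2 \<le> (1 / 4) / (250 / 177)" using r0 by (intro frac_le) auto
    then show ?thesis by simp
  qed
  have "(\<lambda>z. (f z + g z) / 2) \<in> class_U (r0 / sqrt 2)" if f: "f \<in> class_S" and g: "g \<in> class_S" for f g
  proof -
    let ?F = "\<lambda>z. (f z + g z) / 2"
    have hol: "f holomorphic_on ball 0 1" "g holomorphic_on ball 0 1"
      and zero: "f 0 = 0" "g 0 = 0" and one: "deriv f 0 = 1" "deriv g 0 = 1"
      using f g by (auto simp: class_S_def class_A_iff)
    have deriv_F: "deriv ?F z = (deriv f z + deriv g z) / 2" if "z \<in> ball 0 1" for z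
    proof -
      have "(f has_field_derivative deriv f z) (at z)" "(g has_field_derivative deriv g z) (at z)"
        using that hol holomorphic_derivI by blast+
      then have "(?F has_field_derivative (deriv f z + deriv g z) / 2) (at z)"
        by (intro DERIV_cdivide DERIV_add)
      then show ?thesis by (rule DERIV_imp_deriv)
    qed
    have div_z_F: "div_z ?F z = (div_z f z + div_z g z) / 2" if "z \<in> ball 0 1" for z
      using deriv_F[OF that] by (cases "z = 0") (simp_all add: div_z_def add_divide_distrib mult.commute)
    have "?F holomorphic_on ball 0 1" by (intro holomorphic_intros hol) auto
    then have "?F \<in> class_A" by (simp add: class_A_iff zero deriv_F one)
    moreover have "div_z ?F z \<noteq> 0 \<and> norm (deriv ?F z * (1 / div_z ?F z)\<^sup>2 - 1) < 1"
      if "z \<in> ball 0 (r0 / sqrt 2)" for z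
    proof -
      have "norm z < r0 / sqrt 2" using that by simp
      with radius have z: "norm z \<le> 177 / 1000" by linarith
      then have zb: "z \<in> ball 0 1" by simp
      obtain p u where p: "div_z f z * p = 1" "deriv f z = (1 + u) / p\<^sup>2"
        "norm (p - 1) \<le> 2 / 5" "norm u \<le> 1 / 20"
        using class_S_small_disk[OF f z] by blast
      obtain q v where q: "div_z g z * q = 1" "deriv g z = (1 + v) / q\<^sup>2"
        "norm (q - 1) \<le> 2 / 5" "norm v \<le> 1 / 20"
        using class_S_small_disk[OF g z] by blast
      show ?thesis
        using average_U_functional_less_1[OF p(3) q(3) p(4) q(4) p(1) q(1)]
        unfolding deriv_F[OF zb] div_z_F[OF zb] p(2) q(2) by simp
    qed
    ultimately show ?thesis unfolding class_U_def by blast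
  qed
  with root show ?thesis by blast
qed

end
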